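(* Let $\mathcal A$ be the Fermi algebra with local algebras $\mathcal A_n=\mathcal A(J_n)$, where $(J_n)_{n\in\mathbb N}$ is a partition of $\mathbb N$ into finite sets. Let $n\in\mathbb N$ and let $E_{[n+1,n]}:\mathcal A_{[n,n+1]}\to\mathcal A_n$ be an even backward Markov transition expectation. Then the linear map $\widetilde E_{n]}:\mathcal A_{n+1]}\to\mathcal A_{n]}$ determined by $$\widetilde E_{n]}(ab)=a\,E_{[n+1,n]}(b),\qquad a\in\mathcal A_{n-1]},\ b\in\mathcal A_{[n,n+1]},$$ is a quasi-conditional expectation with respect to the triplet $$\mathcal A_{n-1]}\subseteq\mathcal A_{n-1]}\vee\mathcal A_{\{n,+\}}\subseteq\mathcal A_{n+1]}.$$
   Context: The Fermi (CAR) algebra $\mathcal A$ is the unital algebra generated by $\{a_i,a_i^+: i\in\mathbb N\}$ with $a_i^+$ the adjoint of $a_i$ and relations $\{a_j^+,a_k\}=\delta_{jk}1$, $\{a_j,a_k\}=0$, where $\{x,y\}=xy+yx$. For $J\subseteq\mathbb N$, $\mathcal A(J)$ is the $*$-subalgebra generated by $\{a_j,a_j^+:j\in J\}$. Given the partition $(J_n)$, set $\mathcal A_n=\mathcal A(J_n)$, $\mathcal A_I=\mathcal A(\bigcup_{n\in I}J_n)$ for $I\subseteq\mathbb N$, $\mathcal A_{n]}=\mathcal A_{[0,n]}$, $\mathcal A_{-1]}=\mathbb C1$; $\mathcal B\vee\mathcal C$ denotes the $*$-algebra generated by $\mathcal B$ and $\mathcal C$, and $\mathcal B'$ the commutant of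 $\mathcal B$ in $\mathcal A$. If $B_m$ is a linear basis of $\mathcal A_m$ for each $m$, the ordered products of basis elements form a linear basis of $\mathcal A_{n+1]}$, and $\widetilde E_{n]}$ is defined on it by linear extension of $e_{0}\cdots e_{n-1}e_ne_{n+1}\mapsto e_0\cdots e_{n-1}E_{[n+1,n]}(e_ne_{n+1})$, $e_k\in B_k$. $\Theta$ is the automorphism of $\mathcal A$ with $\Theta(a_i)=-a_i$, $\Theta(a_i^+)=-a_i^+$ for all $i$. $\mathcal A_{\{n,+\}}=\{a\in\mathcal A_n:\Theta(a)=a\}$. A map $E$ is even if $E\circ\Theta=E$ on its domain. A linear map $P:\mathcal D\to\mathcal B$ between $*$-algebras is completely positive if $\sum_{j,k=1}^m b_j^*P(d_j^*d_k)b_k\ge0$ for all $m\ge1$, $b_j\in\mathcal B$, $d_j\in\mathcal D$. A backward Markov transition expectation is a completely positive identity preserving map $E_{[n+1,n]}:\mathcal A_{[n,n+1]}\to\mathcal A_n$ with $E_{[n+1,n]}(\mathcal A_{[n,n+1]})\subseteq\mathcal A_{n-1]}'\cap\mathcal A_n$. A quasi-conditional expectation with respect to a triplet $\mathcal C\subseteq\mathcal B\subseteq\mathcal D$ of unital $*$-algebras is a completely positive linear $*$-map $E:\mathcal D\to\mathcal B$ with $E(1)=1$ and $E(ca)=cE(a)$ for all $a\in\mathcal D$, $c\in\mathcal C$.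
   Formalization: For n = 0 it is additionally assumed that E_{[1,0]} takes values in A_{{0,+}}; without this the claim fails at n = 0 (A_{-1]} = C1 makes the commutant condition empty), and for n = 0 the conclusion implies it. *)

theory Defs
  imports Complex_Main "HOL-Library.FuncSet" "HOL-Library.Disjoint_Sets"
begin

text \<open>Unital complex \<open>*\<close>-algebras, with \<open>1 \<noteq> 0\<close> inherited from \<^class>\<open>ring_1\<close>.\<close>

class complex_star_algebra = ring_1 +
  fixes scaleC :: "complex \<Rightarrow> 'a \<Rightarrow> 'a"  (infixr "*\<^sub>C" 75)
    and star :: "'a \<Rightarrow> 'a"
  assumes scaleC_add_right: "c *\<^sub>C (x + y) = c *\<^sub>C x + c *\<^sub>C y"
    and scaleC_add_left: "(c + d) *\<^sub>C x = c *\<^sub>C x + d *\<^sub>C x"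
    and scaleC_scaleC: "c *\<^sub>C d *\<^sub>C x = (c * d) *\<^sub>C x"
    and scaleC_one: "1 *\<^sub>C x = x"
    and mult_scaleC_left: "(c *\<^sub>C x) * y = c *\<^sub>C (x * y)"
    and mult_scaleC_right: "x * (c *\<^sub>C y) = c *\<^sub>C (x * y)"
    and star_star: "star (star x) = x"
    and star_add: "star (x + y) = star x + star y"
    and star_scaleC: "star (c *\<^sub>C x) = cnj c *\<^sub>C star x"
    and star_mult: "star (x * y) = star y * star x"

interpretation cvec: vector_space "scaleC :: complex \<Rightarrow> 'a \<Rightarrow> 'a::complex_star_algebra"
  by standard (simp_all add: scaleC_add_right scaleC_add_left scaleC_scaleC scaleC_one)

definition star_subalgebra :: "'a::complex_star_algebra set \<Rightarrow> bool" where
  "star_subalgebra S \<longleftrightarrow> cvec.subspace S \<and> 1 \<in> S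
     \<and> (\<forall>x\<in>S. \<forall>y\<in>S. x * y \<in> S) \<and> (\<forall>x\<in>S. star x \<in> S)"

definition star_alg_generated :: "'a::complex_star_algebra set \<Rightarrow> 'a set" where
  "star_alg_generated S = star_subalgebra hull S"

definition star_alg_join :: "'a::complex_star_algebra set \<Rightarrow> 'a set \<Rightarrow> 'a set"  (infixl "\<or>\<^sub>*" 65) where
  "S \<or>\<^sub>* T = star_alg_generated (S \<union> T)"

definition commutant :: "'a::complex_star_algebra set \<Rightarrow> 'a set" where
  "commutant S = {x. \<forall>y\<in>S. x * y = y * x}"

text \<open>The cone of positive elements of a \<open>*\<close>-algebra \<open>B\<close>: finite sums of \<open>c\<^sup>* c\<close> with \<open>c \<in> B\<close>.\<close>

definition positive_in :: "'a::complex_star_algebra set \<Rightarrow> 'a \<Rightarrow> bool" where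
  "positive_in B x \<longleftrightarrow> (\<exists>(m::nat) c. (\<forall>k<m. c k \<in> B) \<and> x = (\<Sum>k<m. star (c k) * c k))"

text \<open>Maps between subalgebras are total functions whose values off the domain are irrelevant.\<close>

definition linear_map_on ::
    "'a::complex_star_algebra set \<Rightarrow> 'a set \<Rightarrow> ('a \<Rightarrow> 'a) \<Rightarrow> bool" where
  "linear_map_on D B P \<longleftrightarrow> (\<forall>x\<in>D. P x \<in> B)
     \<and> (\<forall>x\<in>D. \<forall>y\<in>D. P (x + y) = P x + P y)
     \<and> (\<forall>c. \<forall>x\<in>D. P (c *\<^sub>C x) = c *\<^sub>C P x)"

definition completely_positive ::
    "'a::complex_star_algebra set \<Rightarrow> 'a set \<Rightarrow> ('a \<Rightarrow> 'a) \<Rightarrow> bool" where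
  "completely_positive D B P \<longleftrightarrow> linear_map_on D B P
     \<and> (\<forall>(m::nat) b d. m \<ge> 1 \<longrightarrow> (\<forall>j<m. b j \<in> B) \<longrightarrow> (\<forall>j<m. d j \<in> D) \<longrightarrow>
          positive_in B (\<Sum>j<m. \<Sum>k<m. star (b j) * P (star (d j) * d k) * b k))"

definition quasi_conditional_expectation ::
    "'a::complex_star_algebra set \<Rightarrow> 'a set \<Rightarrow> 'a set \<Rightarrow> ('a \<Rightarrow> 'a) \<Rightarrow> bool" where
  "quasi_conditional_expectation C B D E \<longleftrightarrow>
     star_subalgebra C \<and> star_subalgebra B \<and> star_subalgebra D \<and> C \<subseteq> B \<and> B \<subseteq> D
     \<and> completely_positive D B E
     \<and> (\<forall>x\<in>D. E (star x) = star (E x))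
     \<and> E 1 = 1
     \<and> (\<forall>x\<in>D. \<forall>c\<in>C. E (c * x) = c * E x)"

text \<open>The Fermi algebra is the whole type, generated by the \<open>a i\<close> and their adjoints.\<close>

definition fermi_generators :: "(nat \<Rightarrow> 'a::complex_star_algebra) \<Rightarrow> bool" where
  "fermi_generators a \<longleftrightarrow>
     (\<forall>j k. star (a j) * a k + a k * star (a j) = (if j = k then 1 else 0))
     \<and> (\<forall>j k. a j * a k + a k * a j = 0)
     \<and> star_alg_generated (range a) = UNIV"

definition parity_automorphism ::
    "(nat \<Rightarrow> 'a::complex_star_algebra) \<Rightarrow> ('a \<Rightarrow> 'a) \<Rightarrow> bool" where
  "parity_automorphism a \<Theta> \<longleftrightarrow> bij \<Theta> \<and> linear_map_on UNIV UNIV \<Theta>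
     \<and> (\<forall>x y. \<Theta> (x * y) = \<Theta> x * \<Theta> y)
     \<and> (\<forall>i. \<Theta> (a i) = - a i) \<and> (\<forall>i. \<Theta> (star (a i)) = - star (a i))"

definition finite_partition :: "(nat \<Rightarrow> nat set) \<Rightarrow> bool" where
  "finite_partition J \<longleftrightarrow>
     (\<forall>n. finite (J n) \<and> J n \<noteq> {}) \<and> disjoint_family J \<and> (\<Union>n. J n) = UNIV"

text \<open>The algebra of the blocks indexed by \<open>I\<close>. Since generated algebras are unital,
  \<open>block_alg a J {..<0}\<close> consists of the scalar multiples of \<open>1\<close>.\<close>

definition block_alg ::
    "(nat \<Rightarrow> 'a::complex_star_algebra) \<Rightarrow> (nat \<Rightarrow> nat set) \<Rightarrow> nat set \<Rightarrow> 'a set" where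
  "block_alg a J I = star_alg_generated (a ` (\<Union>n\<in>I. J n))"

definition even_part :: "('a \<Rightarrow> 'a) \<Rightarrow> 'a set \<Rightarrow> 'a set" where
  "even_part \<Theta> S = {x\<in>S. \<Theta> x = x}"

definition even_on :: "('a \<Rightarrow> 'a) \<Rightarrow> 'a set \<Rightarrow> ('a \<Rightarrow> 'a) \<Rightarrow> bool" where
  "even_on \<Theta> D E \<longleftrightarrow> (\<forall>x\<in>D. E (\<Theta> x) = E x)"

definition backward_markov_transition_expectation ::
    "(nat \<Rightarrow> 'a::complex_star_algebra) \<Rightarrow> (nat \<Rightarrow> nat set) \<Rightarrow> nat \<Rightarrow> ('a \<Rightarrow> 'a) \<Rightarrow> bool" where
  "backward_markov_transition_expectation a J n E \<longleftrightarrow>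
     completely_positive (block_alg a J {n..n+1}) (block_alg a J {n}) E
     \<and> E 1 = 1
     \<and> E ` block_alg a J {n..n+1} \<subseteq> commutant (block_alg a J {..<n}) \<inter> block_alg a J {n}"

definition linear_basis :: "'a::complex_star_algebra set \<Rightarrow> 'a set \<Rightarrow> bool" where
  "linear_basis B S \<longleftrightarrow> cvec.independent B \<and> cvec.span B = S"

text \<open>\<open>ordered_product e N\<close> is \<open>e 0 * \<dots> * e (N - 1)\<close>.\<close>

definition ordered_product :: "(nat \<Rightarrow> 'a::monoid_mult) \<Rightarrow> nat \<Rightarrow> 'a" where
  "ordered_product e N = prod_list (map e [0..<N])"

definition ordered_basis :: "(nat \<Rightarrow> 'a::complex_star_algebra set) \<Rightarrow> nat \<Rightarrow> 'a set" where
  "ordered_basis B N = (\<lambda>e. ordered_product e N) ` (\<Pi>\<^sub>E k\<in>{..<N}. B k)"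

text \<open>Linear extension, from the ordered products of basis elements, of
  \<open>e\<^sub>0 \<cdots> e\<^sub>n\<^sub>-\<^sub>1 e\<^sub>n e\<^sub>n\<^sub>+\<^sub>1 \<mapsto> e\<^sub>0 \<cdots> e\<^sub>n\<^sub>-\<^sub>1 E (e\<^sub>n e\<^sub>n\<^sub>+\<^sub>1)\<close>:
  \<open>cvec.representation\<close> gives the coordinate of \<open>x\<close> at each ordered product.\<close>

definition extended_expectation ::
    "(nat \<Rightarrow> 'a::complex_star_algebra set) \<Rightarrow> nat \<Rightarrow> ('a \<Rightarrow> 'a) \<Rightarrow> 'a \<Rightarrow> 'a" where
  "extended_expectation B n E x =
     (\<Sum>e\<in>(\<Pi>\<^sub>E k\<in>{..<n+2}. B k).
        cvec.representation (ordered_basis B (n+2)) x (ordered_product e (n+2))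
          *\<^sub>C (ordered_product e n * E (e n * e (n+1))))"

end

theory Submission
  imports Defs
begin

text \<open>Let \<open>V\<close> be the self-adjoint even unitary of \<open>\<A>\<^sub>n\<^sub>-\<^sub>1\<^sub>]\<close> implementing \<open>\<Theta>\<close> there. The
  Klein transformation \<open>y \<mapsto> y\<^sub>+ + V y\<^sub>-\<close>, with \<open>y\<^sub>+\<close> and \<open>y\<^sub>-\<close> the even and odd parts of \<open>y\<close>, is a
  \<open>*\<close>-homomorphism from \<open>\<A>\<^sub>[\<^sub>n\<^sub>,\<^sub>n\<^sub>+\<^sub>1\<^sub>]\<close> into the commutant of \<open>\<A>\<^sub>n\<^sub>-\<^sub>1\<^sub>]\<close>. As \<open>\<A>\<^sub>n\<^sub>-\<^sub>1\<^sub>]\<close> has matrix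
  units \<open>e\<^sub>p\<^sub>q\<close>, the algebra \<open>\<A>\<^sub>n\<^sub>+\<^sub>1\<^sub>]\<close> becomes a matrix algebra over the Klein image. An even \<open>E\<close>
  vanishes on odd elements, so the extension acts entrywise, as \<open>id \<otimes> E\<close>. Factorising the
  positive matrix of the values \<open>E(y\<^sub>i\<^sup>* y\<^sub>j)\<close> writes them as \<open>\<Sum>\<^sub>k F\<^sub>k\<^sub>i\<^sup>* F\<^sub>k\<^sub>j\<close> with even
  \<open>F\<^sub>k\<^sub>i \<in> \<A>\<^sub>n\<close>; these commute with the \<open>e\<^sub>p\<^sub>q\<close>, which exhibits the sums in the definition of
  complete positivity as sums of squares. For \<open>n > 0\<close> the values of \<open>E\<close> are even because an odd
  element of \<open>\<A>\<^sub>n\<close> anticommutes with the odd unitaries of \<open>\<A>\<^sub>n\<^sub>-\<^sub>1\<^sub>]\<close>.\<close>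

section \<open>Star algebras and matrix units\<close>

lemma star_zero [simp]: "star (0::'a::complex_star_algebra) = 0"
proof -
  have "star (0 *\<^sub>C (0::'a)) = cnj 0 *\<^sub>C star 0"
    by (rule star_scaleC)
  then show ?thesis
    by simp
qed

lemma star_one [simp]: "star (1::'a::complex_star_algebra) = 1"
  using star_mult[of 1 "star 1"] by (simp add: star_star)

lemma star_minus: "star (- x) = - star (x::'a::complex_star_algebra)"
  using star_add[of x "- x"] by (simp add: eq_neg_iff_add_eq_0 add.commute)

lemma star_diff: "star (x - y) = star x - star (y::'a::complex_star_algebra)"
  using star_add[of x "- y"] by (simp add: star_minus)

lemma star_sum: "star (\<Sum>i\<in>I. f i) = (\<Sum>i\<in>I. star (f i :: 'a::complex_star_algebra))"
  by (induction I rule: infinite_finite_induct) (simp_all add: star_add)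

lemmas scaleC_simps = mult_scaleC_left mult_scaleC_right scaleC_scaleC scaleC_add_right
  cvec.scale_right_diff_distrib star_add star_minus star_diff star_scaleC star_mult star_star

lemma half_add_half [simp]: "(1/2) *\<^sub>C x + (1/2) *\<^sub>C x = (x::'a::complex_star_algebra)"
  using scaleC_add_left[of "1/2" "1/2" x] by simp

lemma star_subalgebraI:
  assumes "1 \<in> S" "\<And>x y. x \<in> S \<Longrightarrow> y \<in> S \<Longrightarrow> x + y \<in> S"
    and "\<And>c x. x \<in> S \<Longrightarrow> c *\<^sub>C x \<in> S"
    and "\<And>x y. x \<in> S \<Longrightarrow> y \<in> S \<Longrightarrow> x * y \<in> S" "\<And>x. x \<in> S \<Longrightarrow> star x \<in> S"
  shows "star_subalgebra S"
proof -
  have "0 *\<^sub>C 1 \<in> S"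
    using assms by blast
  then have "0 \<in> S"
    by simp
  then show ?thesis
    using assms by (auto simp: star_subalgebra_def cvec.subspace_def)
qed

lemma star_subalgebraD:
  assumes "star_subalgebra S"
  shows "cvec.subspace S" "1 \<in> S" "0 \<in> S" "x \<in> S \<Longrightarrow> y \<in> S \<Longrightarrow> x + y \<in> S"
    "x \<in> S \<Longrightarrow> y \<in> S \<Longrightarrow> x - y \<in> S" "x \<in> S \<Longrightarrow> - x \<in> S"
    "x \<in> S \<Longrightarrow> c *\<^sub>C x \<in> S" "x \<in> S \<Longrightarrow> y \<in> S \<Longrightarrow> x * y \<in> S" "x \<in> S \<Longrightarrow> star x \<in> S"
    "(\<And>i. i \<in> I \<Longrightarrow> f i \<in> S) \<Longrightarrow> sum f I \<in> S"
proof -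
  show S: "cvec.subspace S"
    using assms by (simp add: star_subalgebra_def)
  show "1 \<in> S" "x \<in> S \<Longrightarrow> y \<in> S \<Longrightarrow> x * y \<in> S" "x \<in> S \<Longrightarrow> star x \<in> S"
    using assms by (simp_all add: star_subalgebra_def)
  show "0 \<in> S" "x \<in> S \<Longrightarrow> y \<in> S \<Longrightarrow> x + y \<in> S" "x \<in> S \<Longrightarrow> y \<in> S \<Longrightarrow> x - y \<in> S"
    "x \<in> S \<Longrightarrow> - x \<in> S" "x \<in> S \<Longrightarrow> c *\<^sub>C x \<in> S" "(\<And>i. i \<in> I \<Longrightarrow> f i \<in> S) \<Longrightarrow> sum f I \<in> S"
    by (rule cvec.subspace_0[OF S] cvec.subspace_add[OF S] cvec.subspace_diff[OF S]
        cvec.subspace_neg[OF S] cvec.subspace_scale[OF S] cvec.subspace_sum[OF S]; assumption)+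
qed

lemma star_subalgebra_generated: "star_subalgebra (star_alg_generated S)"
  unfolding star_alg_generated_def
proof (rule hull_in)
  fix T :: "'a set set"
  assume "Ball T star_subalgebra"
  then show "star_subalgebra (\<Inter> T)"
    by (intro star_subalgebraI) (auto intro: star_subalgebraD)
qed

lemma star_alg_generated_superset: "S \<subseteq> star_alg_generated S"
  unfolding star_alg_generated_def by (rule hull_subset)

lemma star_alg_generated_minimal:
  "S \<subseteq> T \<Longrightarrow> star_subalgebra T \<Longrightarrow> star_alg_generated S \<subseteq> T"
  unfolding star_alg_generated_def by (rule hull_minimal)

lemma star_alg_generated_mono: "S \<subseteq> T \<Longrightarrow> star_alg_generated S \<subseteq> star_alg_generated T"
  unfolding star_alg_generated_def by (rule hull_mono)

text \<open>Multiplication is bilinear and the involution conjugate linear, so closure under both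
  only has to be tested on the spanning set.\<close>

lemma star_subalgebra_spanI:
  assumes one: "1 \<in> cvec.span X"
    and mult: "\<And>x y. x \<in> X \<Longrightarrow> y \<in> X \<Longrightarrow> x * y \<in> cvec.span X"
    and star: "\<And>x. x \<in> X \<Longrightarrow> star x \<in> cvec.span X"
  shows "star_subalgebra (cvec.span X)"
proof (rule star_subalgebraI)
  fix u v assume u: "u \<in> cvec.span X" and v: "v \<in> cvec.span X"
  have X: "x * v \<in> cvec.span X" if "x \<in> X" for x
    using v
  proof (induction rule: cvec.span_induct_alt)
    case base
    then show ?case by (simp add: cvec.span_zero)
  next
    case (step c w y)
    then show ?case using mult[OF that]
      by (auto simp: distrib_left mult_scaleC_right intro!: cvec.span_add cvec.span_scale)
  qed
  show "u * v \<in> cvec.span X"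
    using u
  proof (induction rule: cvec.span_induct_alt)
    case base
    then show ?case by (simp add: cvec.span_zero)
  next
    case (step c w y)
    then show ?case using X
      by (auto simp: distrib_right mult_scaleC_left intro!: cvec.span_add cvec.span_scale)
  qed
next
  fix u assume u: "u \<in> cvec.span X"
  show "star u \<in> cvec.span X"
    using u
  proof (induction rule: cvec.span_induct_alt)
    case base
    then show ?case by (simp add: cvec.span_zero)
  next
    case (step c w y)
    then show ?case using star
      by (auto simp: star_add star_scaleC intro!: cvec.span_add cvec.span_scale)
  qed
qed (use one in \<open>auto intro: cvec.span_add cvec.span_scale\<close>)

text \<open>\<open>positive_in\<close> indexes its summands by an initial segment of the naturals;
  an enumeration of \<open>I\<close> transfers this to the index sets that occur later.\<close>

lemma positive_in_sum:
  assumes "finite I" "\<And>i. i \<in> I \<Longrightarrow> c i \<in> S"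
  shows "positive_in S (\<Sum>i\<in>I. star (c i) * c i)"
proof -
  obtain h where h: "bij_betw h {..<card I} I"
    using ex_bij_betw_nat_finite[OF assms(1)] by (auto simp: atLeast0LessThan)
  have "(\<Sum>i\<in>I. star (c i) * c i) = (\<Sum>k<card I. star (c (h k)) * c (h k))"
    by (rule sum.reindex_bij_betw[OF h, symmetric])
  then show ?thesis
    using assms(2) bij_betwE[OF h] unfolding positive_in_def
    by (intro exI[of _ "card I"] exI[of _ "\<lambda>k. c (h k)"]) auto
qed

section \<open>Systems of matrix units and extraction of their coefficients\<close>

definition matrix_units :: "'i set \<Rightarrow> ('i \<Rightarrow> 'i \<Rightarrow> 'a::complex_star_algebra) \<Rightarrow> bool" where
  "matrix_units U e \<longleftrightarrow> finite U
     \<and> (\<forall>p\<in>U. \<forall>q\<in>U. \<forall>r\<in>U. \<forall>s\<in>U. e p q * e r s = (if q = r then e p s else 0))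
     \<and> (\<forall>p\<in>U. \<forall>q\<in>U. star (e p q) = e q p) \<and> (\<Sum>p\<in>U. e p p) = 1"

definition units_span :: "'i set \<Rightarrow> ('i \<Rightarrow> 'i \<Rightarrow> 'a::complex_star_algebra) \<Rightarrow> 'a set" where
  "units_span U e = cvec.span ((\<lambda>(p, q). e p q) ` (U \<times> U))"

lemma matrix_unitsD:
  assumes "matrix_units U e"
  shows "finite U" "p \<in> U \<Longrightarrow> q \<in> U \<Longrightarrow> r \<in> U \<Longrightarrow> s \<in> U \<Longrightarrow> e p q * e r s = (if q = r then e p s else 0)"
    "p \<in> U \<Longrightarrow> q \<in> U \<Longrightarrow> star (e p q) = e q p" "(\<Sum>p\<in>U. e p p) = 1"
  using assms unfolding matrix_units_def by auto

lemma units_span_base: "p \<in> U \<Longrightarrow> q \<in> U \<Longrightarrow> e p q \<in> units_span U e"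
  unfolding units_span_def by (intro cvec.span_base) auto

lemma star_subalgebra_units_span:
  assumes "matrix_units U e"
  shows "star_subalgebra (units_span U e)"
  unfolding units_span_def
proof (rule star_subalgebra_spanI, fold units_span_def)
  have "(\<Sum>p\<in>U. e p p) \<in> units_span U e"
    unfolding units_span_def by (intro cvec.span_sum cvec.span_base) auto
  then show "1 \<in> units_span U e"
    by (simp add: matrix_unitsD[OF assms])
next
  fix x y assume "x \<in> (\<lambda>(p, q). e p q) ` (U \<times> U)" "y \<in> (\<lambda>(p, q). e p q) ` (U \<times> U)"
  then show "x * y \<in> units_span U e"
    by (auto simp: matrix_unitsD[OF assms] units_span_base)
      (simp add: units_span_def cvec.span_zero)
next
  fix x assume "x \<in> (\<lambda>(p, q). e p q) ` (U \<times> U)"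
  then show "star x \<in> units_span U e"
    by (auto simp: matrix_unitsD[OF assms] units_span_base)
qed

lemma units_span_coeffs:
  assumes "matrix_units U e" "x \<in> units_span U e"
  obtains c where "x = (\<Sum>p\<in>U. \<Sum>q\<in>U. c p q *\<^sub>C e p q)"
proof -
  have "\<exists>c. x = (\<Sum>p\<in>U. \<Sum>q\<in>U. c p q *\<^sub>C e p q)"
    using assms(2) unfolding units_span_def
  proof (induction rule: cvec.span_induct_alt)
    case base
    show ?case by (intro exI[of _ "\<lambda>_ _. 0"]) simp
  next
    case (step d w y)
    from step(1) obtain p q where pq: "p \<in> U" "q \<in> U" "w = e p q"
      by auto
    from step(2) obtain c where c: "y = (\<Sum>p\<in>U. \<Sum>q\<in>U. c p q *\<^sub>C e p q)"
      by auto
    \<comment> \<open>The new term is written as a double sum with delta coefficients, so that it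
      can be added to \<open>c\<close> entry by entry.\<close>
    have *: "d *\<^sub>C w = (\<Sum>r\<in>U. \<Sum>s\<in>U. (if r = p then if s = q then d else 0 else 0) *\<^sub>C e r s)"
    proof -
      have "(\<Sum>r\<in>U. \<Sum>s\<in>U. (if r = p then if s = q then d else 0 else 0) *\<^sub>C e r s)
          = (\<Sum>r\<in>U. \<Sum>s\<in>U. if r = p then if s = q then d *\<^sub>C e r s else 0 else 0)"
        by (intro sum.cong) auto
      also have "\<dots> = (\<Sum>r\<in>U. if r = p then \<Sum>s\<in>U. if s = q then d *\<^sub>C e r s else 0 else 0)"
        by (intro sum.cong) auto
      also have "\<dots> = d *\<^sub>C w"
        using pq matrix_unitsD(1)[OF assms(1)] by (simp add: sum.delta')
      finally show ?thesis ..
    qed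
    show ?case
      unfolding * c
      by (intro exI[of _ "\<lambda>r s. (if r = p then if s = q then d else 0 else 0) + c r s"])
        (simp add: scaleC_add_left sum.distrib)
  qed
  then show ?thesis
    using that by blast
qed

text \<open>The multiplication rule kills every term except the one at \<open>(p, q)\<close>, which
  is moved to position \<open>(r, s)\<close>. This is how scalar coefficients are read off.\<close>

lemma units_sandwich:
  assumes "matrix_units U e" "x = (\<Sum>p\<in>U. \<Sum>q\<in>U. c p q *\<^sub>C e p q)"
    and "p \<in> U" "q \<in> U" "r \<in> U" "s \<in> U"
  shows "e r p * x * e q s = c p q *\<^sub>C e r s"
proof -
  note mu = matrix_unitsD[OF assms(1)]
  have "e r p * x * e q s
      = (\<Sum>p'\<in>U. \<Sum>q'\<in>U. c p' q' *\<^sub>C (e r p * e p' q' * e q s))"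
    unfolding assms(2) by (simp add: sum_distrib_left sum_distrib_right scaleC_simps)
  also have "\<dots> = (\<Sum>p'\<in>U. \<Sum>q'\<in>U. if p' = p then if q' = q then c p q *\<^sub>C e r s else 0 else 0)"
    using assms by (intro sum.cong) (auto simp: mu)
  also have "\<dots> = (\<Sum>p'\<in>U. if p' = p then \<Sum>q'\<in>U. if q' = q then c p q *\<^sub>C e r s else 0 else 0)"
    by (intro sum.cong) auto
  also have "\<dots> = c p q *\<^sub>C e r s"
    using assms mu(1) by (simp add: sum.delta')
  finally show ?thesis .
qed

text \<open>In a matrix algebra over the commutant of the units, this is the entry at
  \<open>(p, q)\<close>, spread along the diagonal so that it again commutes with all units.\<close>

definition slice :: "'i set \<Rightarrow> ('i \<Rightarrow> 'i \<Rightarrow> 'a::complex_star_algebra) \<Rightarrow> 'i \<Rightarrow> 'i \<Rightarrow> 'a \<Rightarrow> 'a" where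
  "slice U e p q x = (\<Sum>r\<in>U. e r p * x * e q r)"

lemma slice_units:
  assumes "matrix_units U e" "x = (\<Sum>p\<in>U. \<Sum>q\<in>U. c p q *\<^sub>C e p q)"
    and "p \<in> U" "q \<in> U" and comm: "\<And>r s. r \<in> U \<Longrightarrow> s \<in> U \<Longrightarrow> z * e r s = e r s * z"
  shows "slice U e p q (x * z) = c p q *\<^sub>C z"
proof -
  have "slice U e p q (x * z) = (\<Sum>r\<in>U. (e r p * x * e q r) * z)"
    unfolding slice_def using comm assms(4) by (intro sum.cong) (auto simp: mult.assoc)
  also have "\<dots> = (\<Sum>r\<in>U. c p q *\<^sub>C (e r r * z))"
    by (intro sum.cong) (auto simp: units_sandwich[OF assms(1-4)] scaleC_simps)
  also have "\<dots> = c p q *\<^sub>C ((\<Sum>r\<in>U. e r r) * z)"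
    by (simp add: sum_distrib_right cvec.scale_sum_right)
  finally show ?thesis
    by (simp add: matrix_unitsD[OF assms(1)])
qed

lemma slice_add: "slice U e p q (x + y) = slice U e p q x + slice U e p q y"
  by (simp add: slice_def distrib_left distrib_right sum.distrib)

lemma slice_scaleC: "slice U e p q (c *\<^sub>C x) = c *\<^sub>C slice U e p q x"
  by (simp add: slice_def cvec.scale_sum_right scaleC_simps)

section \<open>Positive kernels\<close>

text \<open>Cholesky factorisation by induction on \<open>S\<close>. If the pivot
  \<open>Q i i\<close> vanishes, so do its row and column; otherwise the Schur complement of the
  pivot is again positive, and the pivot row contributes one more vector. Positivity includes being
  real, which yields Hermitian symmetry.\<close>

lemma positive_kernel_gram:
  fixes Q :: "'k \<Rightarrow> 'k \<Rightarrow> complex"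
  assumes "finite S"
    and "\<And>c. (\<Sum>x\<in>S. \<Sum>y\<in>S. cnj (c x) * c y * Q x y) \<in> complex_of_real ` {0..}"
  shows "\<exists>N G. \<forall>x\<in>S. \<forall>y\<in>S. Q x y = (\<Sum>k<(N::nat). cnj (G k x) * G k y)"
  using assms
proof (induction S arbitrary: Q rule: finite_induct)
  case empty
  show ?case by auto
next
  case (insert i S)
  define q where "q = Re (Q i i)"
  have total: "(\<Sum>x\<in>insert i S. \<Sum>y\<in>insert i S. cnj (c x) * c y * Q x y)
      = cnj (c i) * c i * Q i i + cnj (c i) * (\<Sum>y\<in>S. c y * Q i y)
        + c i * (\<Sum>x\<in>S. cnj (c x) * Q x i) + (\<Sum>x\<in>S. \<Sum>y\<in>S. cnj (c x) * c y * Q x y)" for c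
    using insert(1,2) by (simp add: sum.distrib sum_distrib_left algebra_simps)
  have pos: "cnj (c i) * c i * Q i i + cnj (c i) * (\<Sum>y\<in>S. c y * Q i y)
        + c i * (\<Sum>x\<in>S. cnj (c x) * Q x i) + (\<Sum>x\<in>S. \<Sum>y\<in>S. cnj (c x) * c y * Q x y)
      \<in> complex_of_real ` {0..}" for c
    using insert.prems[of c] unfolding total .
  have q: "Q i i = of_real q" "q \<ge> 0"
    using pos[of "\<lambda>z. if z = i then 1 else 0"] insert(2)
    by (auto simp: q_def sum.neutral cong: sum.cong if_cong)
  \<comment> \<open>The form is tested on vectors supported on \<open>i\<close> and
    \<open>y\<close>, with values \<open>\<alpha>\<close> and \<open>1\<close>.\<close>
  have two: "cnj \<alpha> * \<alpha> * q + cnj \<alpha> * Q i y + \<alpha> * Q y i + Q y y \<in> complex_of_real ` {0..}"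
    if "y \<in> S" for \<alpha> y
  proof -
    have yi: "y \<noteq> i" using that insert(2) by auto
    have 1: "(\<Sum>z\<in>S. (if z = i then \<alpha> else if z = y then 1 else 0) * Q i z) = Q i y"
    proof -
      have "(\<Sum>z\<in>S. (if z = i then \<alpha> else if z = y then 1 else 0) * Q i z)
          = (\<Sum>z\<in>S. if z = y then Q i z else 0)"
        using insert(2) by (intro sum.cong) auto
      then show ?thesis using that insert(1) by simp
    qed
    have 2: "(\<Sum>z\<in>S. cnj (if z = i then \<alpha> else if z = y then 1 else 0) * Q z i) = Q y i"
    proof -
      have "(\<Sum>z\<in>S. cnj (if z = i then \<alpha> else if z = y then 1 else 0) * Q z i)
          = (\<Sum>z\<in>S. if z = y then Q z i else 0)"
        using insert(2) by (intro sum.cong) auto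
      then show ?thesis using that insert(1) by simp
    qed
    have 3: "(\<Sum>u\<in>S. \<Sum>z\<in>S. cnj (if u = i then \<alpha> else if u = y then 1 else 0)
        * (if z = i then \<alpha> else if z = y then 1 else 0) * Q u z) = Q y y"
    proof -
      have "(\<Sum>u\<in>S. \<Sum>z\<in>S. cnj (if u = i then \<alpha> else if u = y then 1 else 0)
          * (if z = i then \<alpha> else if z = y then 1 else 0) * Q u z)
          = (\<Sum>u\<in>S. if u = y then \<Sum>z\<in>S. if z = y then Q u z else 0 else 0)"
        using insert(2) by (intro sum.cong) (auto intro!: sum.cong sum.neutral)
      then show ?thesis using that insert(1) by simp
    qed
    show ?thesis
      using pos[of "\<lambda>z. if z = i then \<alpha> else if z = y then 1 else 0"]
      unfolding 1 2 3 by (simp add: q(1))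
  qed
  \<comment> \<open>The values of the form at \<open>\<alpha> = 1\<close>, \<open>\<i>\<close> and
    \<open>0\<close> have no imaginary part; comparing them polarises to Hermitian symmetry.\<close>
  have herm: "Q y i = cnj (Q i y)" if "y \<in> S" for y
  proof -
    have im: "z \<in> complex_of_real ` {0..} \<Longrightarrow> Im z = 0" for z
      by auto
    have "Im (of_real q + Q i y + Q y i + Q y y) = 0" "Im (of_real q - \<i> * Q i y + \<i> * Q y i + Q y y) = 0"
      "Im (Q y y) = 0"
      using im[OF two[OF that, of 1]] im[OF two[OF that, of \<i>]] im[OF two[OF that, of 0]] by simp_all
    then show ?thesis
      by (simp add: complex_eq_iff)
  qed
  show ?case
  proof (cases "q = 0")
    case True
    have zero: "Q i y = 0" if "y \<in> S" for y
    proof (rule ccontr)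
      assume ne: "Q i y \<noteq> 0"
      \<comment> \<open>With zero pivot the form at \<open>\<alpha> = - t Q i y\<close> equals
        \<open>Q y y - 2 t |Q i y|^2\<close>; this \<open>t\<close> makes its real part minus one,
        against positivity.\<close>
      define t where "t = (Re (Q y y) + 1) / (2 * (cmod (Q i y))\<^sup>2)"
      have "cnj (- (of_real t * Q i y)) * Q i y + - (of_real t * Q i y) * Q y i
          = - (2 * of_real t) * (Q i y * cnj (Q i y))"
        by (simp add: herm[OF that])
      also have "\<dots> = of_real (- (2 * t * (cmod (Q i y))\<^sup>2))"
        by (simp add: complex_norm_square[symmetric])
      also have "2 * t * (cmod (Q i y))\<^sup>2 = Re (Q y y) + 1"
        using ne by (simp add: t_def)
      finally have "of_real (- (Re (Q y y) + 1)) + Q y y \<in> complex_of_real ` {0..}"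
        using two[OF that, of "- (of_real t * Q i y)"] True by simp
      then obtain r where "of_real (- (Re (Q y y) + 1)) + Q y y = complex_of_real r" "r \<ge> 0"
        by auto
      then have "Re (of_real (- (Re (Q y y) + 1)) + Q y y) \<ge> 0"
        by simp
      then show False by simp
    qed
    have "(\<Sum>x\<in>S. \<Sum>y\<in>S. cnj (c x) * c y * Q x y) \<in> complex_of_real ` {0..}" for c
    proof -
      have c: "(\<Sum>x\<in>S. \<Sum>y\<in>S. cnj (c x) * c y * Q x y)
          = (\<Sum>x\<in>S. \<Sum>y\<in>S. cnj ((c(i := 0)) x) * (c(i := 0)) y * Q x y)"
        using insert(2) by (intro sum.cong) auto
      show ?thesis
        using pos[of "c(i := 0)"] unfolding c by simp
    qed
    from insert.IH[OF this] obtain N and G :: "nat \<Rightarrow> 'k \<Rightarrow> complex"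
      where G: "\<forall>x\<in>S. \<forall>y\<in>S. Q x y = (\<Sum>k<N. cnj (G k x) * G k y)"
      by blast
    have "\<forall>x\<in>insert i S. \<forall>y\<in>insert i S. Q x y = (\<Sum>k<N. cnj (((G k)(i := 0)) x) * ((G k)(i := 0)) y)"
      using G zero herm q True insert(2) by (auto intro!: sum.cong)
    then show ?thesis
      by (intro exI[of _ N] exI[of _ "\<lambda>k. (G k)(i := 0)"])
  next
    case False
    then have qpos: "q > 0" using q by simp
    have "(\<Sum>x\<in>S. \<Sum>y\<in>S. cnj (c x) * c y * (Q x y - Q x i * Q i y / q))
        \<in> complex_of_real ` {0..}" for c
    proof -
      define w where "w = (\<Sum>y\<in>S. c y * Q i y)"
      \<comment> \<open>Completing the square: this value at \<open>i\<close> minimises the form for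
        fixed \<open>c\<close> on \<open>S\<close>, and the minimum is the form of the Schur
        complement.\<close>
      define d where "d = c(i := - (w / q))"
      have d: "(\<Sum>y\<in>S. d y * Q i y) = w" "(\<Sum>x\<in>S. cnj (d x) * Q x i) = cnj w"
        "(\<Sum>x\<in>S. \<Sum>y\<in>S. cnj (d x) * d y * Q x y) = (\<Sum>x\<in>S. \<Sum>y\<in>S. cnj (c x) * c y * Q x y)"
        "d i = - (w / q)"
        using insert(2) unfolding w_def d_def by (auto simp: herm intro!: sum.cong)
      have "(\<Sum>x\<in>S. \<Sum>y\<in>S. cnj (c x) * c y * (Q x y - Q x i * Q i y / q))
          = (\<Sum>x\<in>S. \<Sum>y\<in>S. cnj (c x) * c y * Q x y) - cnj w * w / q"
      proof -
        have "cnj w * w = (\<Sum>x\<in>S. \<Sum>y\<in>S. cnj (c x) * c y * (Q x i * Q i y))"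
          unfolding w_def cnj_sum sum_product by (intro sum.cong) (auto simp: herm)
        then show ?thesis
          by (simp add: right_diff_distrib sum_subtractf sum_divide_distrib)
      qed
      also have "\<dots> = cnj (d i) * d i * Q i i + cnj (d i) * w + d i * cnj w
          + (\<Sum>x\<in>S. \<Sum>y\<in>S. cnj (c x) * c y * Q x y)"
        using False by (simp add: d(4) q(1) field_simps)
      finally show ?thesis
        using pos[of d] unfolding d(1-3) by simp
    qed
    from insert.IH[OF this] obtain N and G :: "nat \<Rightarrow> 'k \<Rightarrow> complex"
      where G: "\<forall>x\<in>S. \<forall>y\<in>S. Q x y - Q x i * Q i y / q = (\<Sum>k<N. cnj (G k x) * G k y)"
      by blast
    \<comment> \<open>The old vectors are extended by zero at \<open>i\<close>; the new one, with
      index \<open>N\<close>, is the pivot row divided by the root of the pivot and restores the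
      subtracted rank-one term.\<close>
    define H where "H k x = (if k < N then if x = i then 0 else G k x else Q i x / sqrt q)" for k x
    have sq: "complex_of_real (sqrt q) * complex_of_real (sqrt q) = q"
      using qpos by (simp flip: of_real_mult)
    have herm': "cnj (Q i x) = Q x i" if "x \<in> insert i S" for x
      using that herm q(1) by auto
    have "Q x y = (\<Sum>k<Suc N. cnj (H k x) * H k y)" if "x \<in> insert i S" "y \<in> insert i S" for x y
    proof -
      have "cnj (H N x) * H N y = Q x i * Q i y / q"
        using sq by (simp add: H_def herm'[OF that(1)])
      moreover have "Q x y - Q x i * Q i y / q = (\<Sum>k<N. cnj (H k x) * H k y)"
        using that G False insert(2) by (auto simp: H_def q(1) intro!: sum.cong)
      ultimately show ?thesis
        by (simp add: algebra_simps)
    qed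
    then show ?thesis by blast
  qed
qed

section \<open>Parity and local matrix units of the Fermi algebra\<close>

locale fermi =
  fixes a :: "nat \<Rightarrow> 'a::complex_star_algebra" and \<Theta> :: "'a \<Rightarrow> 'a"
  assumes generators: "fermi_generators a"
    and parity: "parity_automorphism a \<Theta>"
begin

section \<open>Anticommutation relations and the algebras of sets of modes\<close>

lemma car:
  "star (a j) * a k + a k * star (a j) = (if j = k then 1 else 0)"
  "a j * a k + a k * a j = 0"
  using generators unfolding fermi_generators_def by blast+

lemma car':
  "star (a j) * star (a k) + star (a k) * star (a j) = 0"
  using arg_cong[OF car(2)[of k j], of star] by (simp add: star_add star_mult)

lemma square_zero: "a j * a j = 0" "star (a j) * star (a j) = 0"
proof -
  have *: "x = 0" if "x + x = 0" for x :: 'a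
    using scaleC_add_right[of "1/2" x x] that by simp
  show "a j * a j = 0" "star (a j) * star (a j) = 0"
    by (rule *[OF car(2)[of j j]] *[OF car'[of j j]])+
qed

definition alg :: "nat set \<Rightarrow> 'a set" where
  "alg K = star_alg_generated (a ` K)"

lemma alg_UNIV: "alg UNIV = UNIV"
  using generators unfolding fermi_generators_def alg_def by blast

lemma star_subalgebra_alg: "star_subalgebra (alg K)"
  unfolding alg_def by (rule star_subalgebra_generated)

lemmas algI = star_subalgebraD[OF star_subalgebra_alg]

lemma gen_in_alg: "j \<in> K \<Longrightarrow> a j \<in> alg K"
  unfolding alg_def using star_alg_generated_superset by blast

lemma alg_mono: "K \<subseteq> L \<Longrightarrow> alg K \<subseteq> alg L"
  unfolding alg_def by (intro star_alg_generated_mono image_mono)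

text \<open>\<open>alg K\<close> is known through its minimality, so induction means that the
  property cuts out a star subalgebra. Adjoints of the generators are covered by closure under the
  star.\<close>

lemma alg_induct:
  assumes "x \<in> alg K" "star_subalgebra {x. P x}" "\<And>j. j \<in> K \<Longrightarrow> P (a j)"
  shows "P x"
  using star_alg_generated_minimal[OF _ assms(2), of "a ` K"] assms(1,3) unfolding alg_def by blast

section \<open>The parity automorphism\<close>

lemma \<Theta>_add: "\<Theta> (x + y) = \<Theta> x + \<Theta> y"
  and \<Theta>_scaleC: "\<Theta> (c *\<^sub>C x) = c *\<^sub>C \<Theta> x"
  and \<Theta>_mult: "\<Theta> (x * y) = \<Theta> x * \<Theta> y"
  and \<Theta>_gen: "\<Theta> (a j) = - a j"
  and \<Theta>_star_gen: "\<Theta> (star (a j)) = - star (a j)"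
  using parity unfolding parity_automorphism_def linear_map_on_def by blast+

lemma \<Theta>_zero [simp]: "\<Theta> 0 = 0"
  using \<Theta>_scaleC[of 0 0] by simp

lemma \<Theta>_minus: "\<Theta> (- x) = - \<Theta> x"
  using \<Theta>_add[of x "- x"] by (simp add: eq_neg_iff_add_eq_0 add.commute)

lemma \<Theta>_diff: "\<Theta> (x - y) = \<Theta> x - \<Theta> y"
  using \<Theta>_add[of x "- y"] by (simp add: \<Theta>_minus)

text \<open>Unitality comes from surjectivity: for a preimage \<open>x\<close> of \<open>1\<close>,
  multiplicativity on \<open>1 * x\<close> gives \<open>\<Theta> 1 * 1 = 1\<close>.\<close>

lemma \<Theta>_one [simp]: "\<Theta> 1 = 1"
proof -
  obtain x where x: "\<Theta> x = 1"
    using parity unfolding parity_automorphism_def bij_def surj_def by metis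
  show ?thesis
    using \<Theta>_mult[of 1 x] x by simp
qed

text \<open>The values on \<open>a i\<close> and \<open>star (a i)\<close> are given; compatibility
  with the star propagates from them because it defines a star subalgebra.\<close>

lemma \<Theta>_star: "\<Theta> (star x) = star (\<Theta> x)"
proof (rule alg_induct[of x UNIV])
  show "star_subalgebra {x. \<Theta> (star x) = star (\<Theta> x)}"
    by (rule star_subalgebraI)
      (auto simp: star_add star_scaleC star_mult star_star \<Theta>_add \<Theta>_scaleC \<Theta>_mult)
qed (auto simp: alg_UNIV \<Theta>_gen \<Theta>_star_gen star_minus)

lemma \<Theta>_\<Theta> [simp]: "\<Theta> (\<Theta> x) = x"
proof (rule alg_induct[of x UNIV])
  show "star_subalgebra {x. \<Theta> (\<Theta> x) = x}"
    by (rule star_subalgebraI) (auto simp: \<Theta>_star \<Theta>_add \<Theta>_scaleC \<Theta>_mult)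
qed (auto simp: alg_UNIV \<Theta>_gen \<Theta>_minus)

lemma \<Theta>_in_alg: "x \<in> alg K \<Longrightarrow> \<Theta> x \<in> alg K"
proof (erule alg_induct)
  show "star_subalgebra {x. \<Theta> x \<in> alg K}"
    by (rule star_subalgebraI) (auto simp: \<Theta>_star \<Theta>_add \<Theta>_scaleC \<Theta>_mult intro: algI)
qed (auto simp: \<Theta>_gen intro: algI gen_in_alg)

lemmas \<Theta>_simps = \<Theta>_add \<Theta>_scaleC \<Theta>_mult \<Theta>_minus \<Theta>_diff \<Theta>_star

section \<open>Decomposition into even and odd parts\<close>

definition ev :: "'a \<Rightarrow> 'a" where
  "ev x = (1/2) *\<^sub>C (x + \<Theta> x)"

definition od :: "'a \<Rightarrow> 'a" where
  "od x = (1/2) *\<^sub>C (x - \<Theta> x)"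

lemma ev_od: "ev x + od x = x"
proof -
  have "ev x + od x = (1/2) *\<^sub>C (x + x)"
    unfolding ev_def od_def by (simp flip: scaleC_add_right)
  then show ?thesis
    by (simp add: scaleC_add_right)
qed

lemma \<Theta>_ev: "\<Theta> (ev x) = ev x"
  by (simp add: ev_def \<Theta>_simps add.commute)

lemma \<Theta>_od: "\<Theta> (od x) = - od x"
  unfolding od_def \<Theta>_scaleC \<Theta>_diff by (simp flip: cvec.scale_minus_right)

text \<open>A splitting into an even and an odd summand is unique, so both parts can be computed by
  exhibiting one, as in \<open>ev_mult\<close>.\<close>

lemma ev_od_unique:
  assumes "\<Theta> x = x" "\<Theta> y = - y"
  shows "ev (x + y) = x" "od (x + y) = y"
  by (simp_all add: ev_def od_def \<Theta>_simps assms scaleC_add_right)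

lemma ev_eq: "\<Theta> x = x \<Longrightarrow> ev x = x"
  and od_eq: "\<Theta> x = x \<Longrightarrow> od x = 0"
  using ev_od_unique[of x 0] by auto

lemma
  shows ev_add: "ev (x + y) = ev x + ev y"
    and od_add: "od (x + y) = od x + od y"
    and ev_scaleC: "ev (c *\<^sub>C x) = c *\<^sub>C ev x"
    and od_scaleC: "od (c *\<^sub>C x) = c *\<^sub>C od x"
    and ev_star: "ev (star x) = star (ev x)"
    and od_star: "od (star x) = star (od x)"
  by (simp_all add: ev_def od_def \<Theta>_simps scaleC_simps algebra_simps)

lemma ev_mult: "ev (x * y) = ev x * ev y + od x * od y"
  and od_mult: "od (x * y) = ev x * od y + od x * ev y"
proof -
  have *: "x * y = (ev x * ev y + od x * od y) + (ev x * od y + od x * ev y)"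
  proof -
    have "x * y = (ev x + od x) * (ev y + od y)"
      by (simp add: ev_od)
    then show ?thesis
      by (simp add: algebra_simps)
  qed
  show "ev (x * y) = ev x * ev y + od x * od y"
    unfolding * by (rule ev_od_unique) (simp_all add: \<Theta>_simps \<Theta>_ev \<Theta>_od)
  show "od (x * y) = ev x * od y + od x * ev y"
    unfolding * by (rule ev_od_unique) (simp_all add: \<Theta>_simps \<Theta>_ev \<Theta>_od)
qed

lemma ev_od_in_alg: "x \<in> alg K \<Longrightarrow> ev x \<in> alg K" "x \<in> alg K \<Longrightarrow> od x \<in> alg K"
  unfolding ev_def od_def by (auto intro!: algI \<Theta>_in_alg)

text \<open>For finite \<open>K\<close> this is, up to sign, \<open>(-1)^N\<close> with
  \<open>N\<close> the number of particles in the modes of \<open>K\<close>. The last clause records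
  that, being even, it commutes with the algebras of all other modes.\<close>

definition parity_op :: "nat set \<Rightarrow> 'a \<Rightarrow> bool" where
  "parity_op K V \<longleftrightarrow> V \<in> alg K \<and> star V = V \<and> V * V = 1 \<and> \<Theta> V = V
     \<and> (\<forall>x\<in>alg K. V * x = \<Theta> x * V) \<and> (\<forall>L. L \<inter> K = {} \<longrightarrow> (\<forall>y\<in>alg L. V * y = y * V))"

lemma parity_opD:
  assumes "parity_op K V"
  shows "V \<in> alg K" "star V = V" "V * V = 1" "\<Theta> V = V" "x \<in> alg K \<Longrightarrow> V * x = \<Theta> x * V"
    "y \<in> alg L \<Longrightarrow> L \<inter> K = {} \<Longrightarrow> V * y = y * V"
  using assms unfolding parity_op_def by blast+

text \<open>Both commutation clauses are tested on generators. Closure under the star uses that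
  \<open>V\<close> is self-adjoint, and in the first clause also \<open>V * V = 1\<close>.\<close>

lemma parity_opI:
  assumes V: "V \<in> alg K" "star V = V" "V * V = 1" "\<Theta> V = V"
    and anti: "\<And>k. k \<in> K \<Longrightarrow> V * a k = - a k * V" and comm: "\<And>k. k \<notin> K \<Longrightarrow> V * a k = a k * V"
  shows "parity_op K V"
  unfolding parity_op_def
proof (intro conjI ballI allI impI)
  fix x assume "x \<in> alg K"
  then show "V * x = \<Theta> x * V"
  proof (rule alg_induct)
    show "star_subalgebra {x. V * x = \<Theta> x * V}"
    proof (rule star_subalgebraI; simp)
      fix x y assume "V * x = \<Theta> x * V" "V * y = \<Theta> y * V"
      then show "V * (x * y) = \<Theta> (x * y) * V"
        by (metis \<Theta>_mult mult.assoc)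
    next
      fix x assume "V * x = \<Theta> x * V"
      then have "x * V = V * \<Theta> x"
        by (metis V(3) mult.assoc mult.left_neutral mult.right_neutral)
      then show "V * star x = \<Theta> (star x) * V"
        by (metis V(2) \<Theta>_star star_mult)
    qed (simp_all add: \<Theta>_simps distrib_left distrib_right scaleC_simps)
  qed (simp add: anti \<Theta>_gen)
next
  fix L y assume L: "L \<inter> K = {}" "y \<in> alg L"
  from L(2) show "V * y = y * V"
  proof (rule alg_induct)
    show "star_subalgebra {y. V * y = y * V}"
    proof (rule star_subalgebraI; simp)
      fix x y assume "V * x = x * V" "V * y = y * V"
      then show "V * (x * y) = x * y * V"
        by (metis mult.assoc)
    next
      fix x assume "V * x = x * V"
      then show "V * star x = star x * V"
        by (metis V(2) star_mult)
    qed (simp_all add: distrib_left distrib_right scaleC_simps)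
  next
    fix j assume "j \<in> L"
    then show "V * a j = a j * V"
      using L(1) by (intro comm) auto
  qed
qed (use V in auto)

lemma number_op_square: "star (a j) * a j * (star (a j) * a j) = star (a j) * a j"
proof -
  have "star (a j) * a j = 1 - a j * star (a j)"
    using car(1)[of j j] by (simp add: algebra_simps)
  then have "star (a j) * a j * (star (a j) * a j) = star (a j) * a j * (1 - a j * star (a j))"
    by simp
  also have "\<dots> = star (a j) * a j - star (a j) * (a j * a j) * star (a j)"
    by (simp add: algebra_simps)
  finally show ?thesis
    by (simp add: square_zero)
qed

text \<open>For one mode the operator is \<open>1 - 2 N\<close> with
  \<open>N = star (a j) * a j\<close>, a projection by \<open>number_op_square\<close>; the factor
  two is spelled as a repeated subtraction.\<close>

lemma parity_op_singleton: "parity_op {j} (1 - star (a j) * a j - star (a j) * a j)"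
proof (rule parity_opI)
  let ?N = "star (a j) * a j"
  show "1 - ?N - ?N \<in> alg {j}"
    by (intro algI gen_in_alg) auto
  show "star (1 - ?N - ?N) = 1 - ?N - ?N" "\<Theta> (1 - ?N - ?N) = 1 - ?N - ?N"
    by (simp_all add: star_diff star_mult star_star \<Theta>_simps \<Theta>_gen star_minus)
  have "(1 - ?N - ?N) * (1 - ?N - ?N) = 1 - ?N - ?N - ?N - ?N + (?N * ?N + ?N * ?N + ?N * ?N + ?N * ?N)"
    by (simp add: algebra_simps)
  then show "(1 - ?N - ?N) * (1 - ?N - ?N) = 1"
    unfolding number_op_square by (simp add: algebra_simps)
next
  fix k assume "k \<in> {j}"
  then have k: "k = j" by simp
  have "star (a j) * a j + a j * star (a j) = 1"
    using car(1)[of j j] by simp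
  then have "a j * (star (a j) * a j + a j * star (a j)) = a j"
    by simp
  then have "a j * star (a j) * a j = a j"
    by (simp add: distrib_left mult.assoc[symmetric] square_zero)
  moreover have "star (a j) * a j * a j = 0"
    by (simp add: mult.assoc square_zero)
  ultimately show "(1 - star (a j) * a j - star (a j) * a j) * a k
      = - a k * (1 - star (a j) * a j - star (a j) * a j)"
    by (simp add: k left_diff_distrib right_diff_distrib mult.assoc[symmetric])
next
  fix k assume "k \<notin> {j}"
  then have "j \<noteq> k" by simp
  then have 1: "star (a j) * a k = - (a k * star (a j))" "a j * a k = - (a k * a j)"
    using car(1)[of j k] car(2)[of j k] by (simp_all add: eq_neg_iff_add_eq_0)
  \<comment> \<open>Moving \<open>a k\<close> past the number operator of another mode costs two
    signs, which cancel.\<close>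
  have "star (a j) * a j * a k = star (a j) * (a j * a k)"
    by (simp add: mult.assoc)
  also have "\<dots> = - (star (a j) * a k) * a j"
    unfolding 1(2) by (simp add: mult.assoc)
  also have "\<dots> = a k * (star (a j) * a j)"
    unfolding 1(1) by (simp add: mult.assoc)
  finally show "(1 - star (a j) * a j - star (a j) * a j) * a k
      = a k * (1 - star (a j) * a j - star (a j) * a j)"
    by (simp add: left_diff_distrib right_diff_distrib)
qed

text \<open>Parities of disjoint mode sets multiply: a generator of the union anticommutes with
  exactly one of the two factors, any other generator commutes with both.\<close>

lemma parity_op_insert:
  assumes V: "parity_op K V" and W: "parity_op {j} W" and j: "j \<notin> K"
  shows "parity_op (insert j K) (V * W)"
proof (rule parity_opI)
  have VW: "V * W = W * V"
    using parity_opD(6)[OF V parity_opD(1)[OF W]] j by simp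
  have "V \<in> alg (insert j K)" "W \<in> alg (insert j K)"
    using parity_opD(1)[OF V] parity_opD(1)[OF W] alg_mono[of K "insert j K"]
      alg_mono[of "{j}" "insert j K"] by auto
  then show "V * W \<in> alg (insert j K)"
    by (rule algI)
  show "star (V * W) = V * W"
    by (simp add: star_mult parity_opD[OF V] parity_opD[OF W] VW)
  show "V * W * (V * W) = 1"
    by (metis VW V W mult.assoc mult.right_neutral parity_opD(3))
  show "\<Theta> (V * W) = V * W"
    by (simp add: \<Theta>_mult parity_opD[OF V] parity_opD[OF W])
  fix k
  have V_in: "V * a k = - a k * V" if "k \<in> K"
    using parity_opD(5)[OF V gen_in_alg[OF that]] by (simp add: \<Theta>_gen)
  have V_out: "V * a k = a k * V" if "k \<notin> K"
    using parity_opD(6)[OF V gen_in_alg[of k "{k}"]] that by simp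
  have W_in: "W * a k = - a k * W" if "k = j"
    using parity_opD(5)[OF W gen_in_alg[of k "{j}"]] that by (simp add: \<Theta>_gen)
  have W_out: "W * a k = a k * W" if "k \<noteq> j"
    using parity_opD(6)[OF W gen_in_alg[of k "{k}"]] that by simp
  {
    assume "k \<in> insert j K"
    then consider "k = j" "k \<notin> K" | "k \<noteq> j" "k \<in> K"
      using j by auto
    then show "V * W * a k = - a k * (V * W)"
    proof cases
      case 1
      then show ?thesis
        using W_in V_out by (simp add: mult.assoc) (simp add: mult.assoc[symmetric])
    next
      case 2
      then show ?thesis
        using W_out V_in by (simp add: mult.assoc) (simp add: mult.assoc[symmetric])
    qed
  }
  {
    assume "k \<notin> insert j K"
    then show "V * W * a k = a k * (V * W)"
      using W_out V_out by (simp add: mult.assoc) (simp add: mult.assoc[symmetric])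
  }
qed

lemma parity_op_exists:
  assumes "finite K"
  shows "\<exists>V. parity_op K V"
  using assms
proof (induction rule: finite_induct)
  case empty
  have "parity_op {} 1"
    by (rule parity_opI) (auto intro: algI)
  then show ?case ..
next
  case (insert j K)
  then show ?case
    using parity_op_insert parity_op_singleton by blast
qed

text \<open>The Klein transformation: \<open>twist V\<close> embeds the algebra of the modes outside \<open>K\<close>
  into the commutant of the algebra of the modes in \<open>K\<close>.\<close>

definition twist :: "'a \<Rightarrow> 'a \<Rightarrow> 'a" where
  "twist V y = ev y + V * od y"

lemma twist_add: "twist V (x + y) = twist V x + twist V y"
  by (simp add: twist_def ev_add od_add algebra_simps)

lemma twist_scaleC: "twist V (c *\<^sub>C x) = c *\<^sub>C twist V x"
  by (simp add: twist_def ev_scaleC od_scaleC scaleC_simps)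

text \<open>\<open>V\<close> commutes with \<open>alg L\<close> and squares to one, so the two
  copies of \<open>V\<close> in a product of odd parts cancel, matching
  \<open>ev_mult\<close>.\<close>

lemma twist_mult:
  assumes "parity_op K V" "L \<inter> K = {}" "x \<in> alg L" "y \<in> alg L"
  shows "twist V (x * y) = twist V x * twist V y"
proof -
  have V: "V * u = u * V" if "u \<in> alg L" for u
    using parity_opD(6)[OF assms(1) that assms(2)] .
  have "twist V x * twist V y
      = ev x * ev y + V * od x * ev y + (ev x * V) * od y + V * (od x * V) * od y"
    by (simp add: twist_def algebra_simps)
  also have "\<dots> = ev x * ev y + V * od x * ev y + V * ev x * od y + (V * V) * od x * od y"
    using V[OF ev_od_in_alg(1)[OF assms(3)]] V[OF ev_od_in_alg(2)[OF assms(3)]]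
    by (simp add: mult.assoc)
  also have "\<dots> = twist V (x * y)"
    by (simp add: twist_def ev_mult od_mult parity_opD[OF assms(1)] algebra_simps)
  finally show ?thesis ..
qed

lemma twist_star:
  assumes "parity_op K V" "L \<inter> K = {}" "x \<in> alg L"
  shows "twist V (star x) = star (twist V x)"
  using parity_opD(6)[OF assms(1) _ assms(2), of "od (star x)"] assms(3)
  by (simp add: twist_def star_add star_mult ev_star od_star parity_opD(2)[OF assms(1)]
      algI ev_od_in_alg flip: od_star)

text \<open>The graded commutation rule for an odd generator outside \<open>K\<close>. Both forms
  are proved together because taking adjoints exchanges them.\<close>

lemma gen_anticommute:
  assumes "x \<in> alg K" "j \<notin> K"
  shows "a j * x = \<Theta> x * a j \<and> star (a j) * x = \<Theta> x * star (a j)"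
  using assms(1)
proof (rule alg_induct)
  show "star_subalgebra {x. a j * x = \<Theta> x * a j \<and> star (a j) * x = \<Theta> x * star (a j)}"
  proof (rule star_subalgebraI; clarsimp)
    fix x y assume "a j * x = \<Theta> x * a j" "star (a j) * x = \<Theta> x * star (a j)"
      "a j * y = \<Theta> y * a j" "star (a j) * y = \<Theta> y * star (a j)"
    then show "a j * (x * y) = \<Theta> (x * y) * a j \<and> star (a j) * (x * y) = \<Theta> (x * y) * star (a j)"
      by (metis \<Theta>_mult mult.assoc)
  next
    fix x assume x: "a j * x = \<Theta> x * a j" "star (a j) * x = \<Theta> x * star (a j)"
    have "a j * \<Theta> x = x * a j" "star (a j) * \<Theta> x = x * star (a j)"
      using arg_cong[OF x(1), of \<Theta>] arg_cong[OF x(2), of \<Theta>]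
      by (simp_all add: \<Theta>_mult \<Theta>_gen \<Theta>_star star_minus)
    then show "a j * star x = \<Theta> (star x) * a j \<and> star (a j) * star x = \<Theta> (star x) * star (a j)"
      by (metis star_mult star_star \<Theta>_star)
  qed (auto simp: \<Theta>_simps distrib_left distrib_right scaleC_simps)
next
  fix k assume "k \<in> K"
  then have "j \<noteq> k" using assms(2) by auto
  then show "a j * a k = \<Theta> (a k) * a j \<and> star (a j) * a k = \<Theta> (a k) * star (a j)"
    using car(1)[of j k] car(2)[of j k] by (simp add: \<Theta>_gen eq_neg_iff_add_eq_0)
qed

text \<open>For a generator of \<open>alg L\<close>, passing \<open>a j\<close> and passing
  \<open>V\<close> each apply \<open>\<Theta>\<close> to \<open>x\<close>, and
  \<open>\<Theta>\<close> is an involution. The rest follows because the Klein transformation is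
  multiplicative and respects the star.\<close>

lemma twist_commute:
  assumes V: "parity_op K V" and L: "L \<inter> K = {}" and x: "x \<in> alg K" and y: "y \<in> alg L"
  shows "twist V y * x = x * twist V y"
proof -
  \<comment> \<open>Membership in \<open>alg L\<close> is part of the induction property, since
    \<open>twist_mult\<close> and \<open>twist_star\<close> need it.\<close>
  have "y \<in> alg L \<and> (\<forall>x\<in>alg K. twist V y * x = x * twist V y)"
    using y
  proof (rule alg_induct)
    show "star_subalgebra {y. y \<in> alg L \<and> (\<forall>x\<in>alg K. twist V y * x = x * twist V y)}"
      (is "star_subalgebra ?S")
    proof (rule star_subalgebraI)
      show "1 \<in> ?S"
        by (simp add: algI twist_def ev_eq od_eq)
    next
      fix y z assume y: "y \<in> ?S" and z: "z \<in> ?S"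
      then show "y + z \<in> ?S"
        by (simp add: algI twist_add distrib_left distrib_right)
      have "twist V (y * z) * x = x * twist V (y * z)" if x: "x \<in> alg K" for x
      proof -
        have tw: "twist V (y * z) = twist V y * twist V z"
          using y z by (intro twist_mult[OF V L]) auto
        have "twist V y * (twist V z * x) = twist V y * x * twist V z"
          using z x by (simp add: mult.assoc)
        also have "\<dots> = x * (twist V y * twist V z)"
          using y x by (simp add: mult.assoc)
        finally show ?thesis
          by (simp add: tw mult.assoc)
      qed
      then show "y * z \<in> ?S"
        using y z by (simp add: algI)
    next
      fix c y assume y: "y \<in> ?S"
      then show "c *\<^sub>C y \<in> ?S"
        by (simp add: algI twist_scaleC scaleC_simps)
    next
      fix y assume y: "y \<in> ?S"
      have "twist V (star y) * x = x * twist V (star y)" if x: "x \<in> alg K" for x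
      proof -
        have "star (twist V y * star x) = star (star x * twist V y)"
          using y algI(9)[OF x] by simp
        then show ?thesis
          using y by (simp add: twist_star[OF V L] star_mult star_star)
      qed
      then show "star y \<in> ?S"
        using y by (simp add: algI)
    qed
  next
    fix j assume j: "j \<in> L"
    have tw: "twist V (a j) = V * a j"
      using ev_od_unique[of 0 "a j"] by (simp add: twist_def \<Theta>_gen)
    show "a j \<in> alg L \<and> (\<forall>x\<in>alg K. twist V (a j) * x = x * twist V (a j))"
    proof (intro conjI ballI)
      have jK: "j \<notin> K"
        using j L by blast
      show "a j \<in> alg L" using j by (rule gen_in_alg)
      fix x assume x: "x \<in> alg K"
      have "V * a j * x = V * \<Theta> x * a j"
        using gen_anticommute[OF x jK] by (simp add: mult.assoc)
      also have "V * \<Theta> x = x * V"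
        using parity_opD(5)[OF V \<Theta>_in_alg[OF x]] by simp
      finally show "twist V (a j) * x = x * twist V (a j)"
        by (simp add: tw mult.assoc)
    qed
  qed
  then show ?thesis using x by blast
qed


text \<open>The two-by-two matrix units of the mode \<open>j\<close> after the Klein transformation,
  with \<open>True\<close> for the empty and \<open>False\<close> for the occupied level;
  \<open>a j\<close> takes the occupied level to the empty one.\<close>

definition mode_unit :: "'a \<Rightarrow> nat \<Rightarrow> bool \<Rightarrow> bool \<Rightarrow> 'a" where
  "mode_unit V j s t = twist V (if s then if t then a j * star (a j) else a j
      else if t then star (a j) else star (a j) * a j)"

text \<open>The Klein factor makes the units of the new mode commute with \<open>alg K\<close>. The
  fourth property undoes it, so that the generator \<open>a j\<close> can be recovered.\<close>

lemma mode_unit: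
  fixes g
  assumes V: "parity_op K V" and j: "j \<notin> K" and g_def: "g = mode_unit V j"
  shows "g s t * g u v = (if t = u then g s v else 0)" "star (g s t) = g t s"
    "g True True + g False False = 1" "V * g True False = a j"
    "x \<in> alg K \<Longrightarrow> g s t * x = x * g s t" "g s t \<in> alg (insert j K)"
proof -
  have disj: "{j} \<inter> K = {}"
    using j by auto
  define h where "h s t = (if s then if t then a j * star (a j) else a j
      else if t then star (a j) else star (a j) * a j)" for s t
  have g: "g s t = twist V (h s t)" for s t
    by (simp add: g_def h_def mode_unit_def)
  have h: "h s t \<in> alg {j}" for s t
    by (auto simp: h_def intro!: algI gen_in_alg)
  have n: "star (a j) * a j + a j * star (a j) = 1"
    using car(1)[of j j] by simp
  have zero: "a j * (a j * z) = 0" "star (a j) * (star (a j) * z) = 0" for z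
    using square_zero[of j] by (simp_all flip: mult.assoc)
  have aba: "a j * (star (a j) * a j) = a j" "star (a j) * (a j * star (a j)) = star (a j)"
    using arg_cong[OF n, of "\<lambda>z. a j * z"] arg_cong[OF n, of "\<lambda>z. star (a j) * z"]
    by (simp_all add: distrib_left square_zero zero)
  have aba': "a j * (star (a j) * (a j * z)) = a j * z"
    "star (a j) * (a j * (star (a j) * z)) = star (a j) * z" for z
    using aba by (metis mult.assoc)+
  have hh: "h s t * h u v = (if t = u then h s v else 0)" for s t u v
    by (cases s; cases t; cases u; cases v)
      (simp_all add: h_def mult.assoc square_zero zero aba aba')
  have hstar: "star (h s t) = h t s" for s t
    by (simp add: h_def star_mult star_star)
  have tw0: "twist V 0 = 0" and tw1: "twist V 1 = 1"
    by (simp_all add: twist_def ev_eq od_eq)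
  show "g s t * g u v = (if t = u then g s v else 0)"
    unfolding g using twist_mult[OF V disj h h, of s t u v] by (auto simp: hh tw0)
  show "star (g s t) = g t s"
    unfolding g using twist_star[OF V disj h, of s t] by (simp add: hstar)
  have "h True True + h False False = 1"
    using n by (simp add: h_def add.commute)
  then show "g True True + g False False = 1"
    unfolding g by (metis twist_add tw1)
  have "twist V (a j) = V * a j"
    using ev_od_unique[of 0 "a j"] by (simp add: twist_def \<Theta>_gen)
  then show "V * g True False = a j"
    unfolding g by (simp add: h_def parity_opD(3)[OF V] flip: mult.assoc)
  show "g s t * x = x * g s t" if "x \<in> alg K"
    unfolding g by (rule twist_commute[OF V disj that h])
  have "alg {j} \<subseteq> alg (insert j K)" "alg K \<subseteq> alg (insert j K)"
    by (auto intro!: alg_mono)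
  then show "g s t \<in> alg (insert j K)"
    unfolding g twist_def using h[of s t] parity_opD(1)[OF V]
    by (auto intro!: algI ev_od_in_alg)
qed

text \<open>Jordan-Wigner: adjoining a mode tensors the units of \<open>alg K\<close> with commuting
  two-by-two units. A subset of \<open>K\<close> lists the modes at level \<open>True\<close>, so
  \<open>alg K\<close> is the full matrix algebra of size \<open>2^|K|\<close>.\<close>

lemma matrix_units_exist:
  assumes "finite K"
  shows "\<exists>e. matrix_units (Pow K) e \<and> units_span (Pow K) e = alg K"
  using assms
proof (induction rule: finite_induct)
  case empty
  have mu: "matrix_units (Pow {}) (\<lambda>_ _. 1 :: 'a)"
    by (simp add: matrix_units_def)
  have "units_span (Pow {}) (\<lambda>_ _. 1 :: 'a) = alg {}"
  proof
    show "units_span (Pow {}) (\<lambda>_ _. 1) \<subseteq> alg {}"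
      unfolding units_span_def by (intro cvec.span_minimal algI) (auto intro: algI)
    show "alg {} \<subseteq> units_span (Pow {}) (\<lambda>_ _. 1 :: 'a)"
      unfolding alg_def
      by (intro star_alg_generated_minimal star_subalgebra_units_span mu) auto
  qed
  then show ?case using mu by blast
next
  case (insert j K)
  then obtain e where e: "matrix_units (Pow K) e" "units_span (Pow K) e = alg K"
    by blast
  obtain V where V: "parity_op K V"
    using parity_op_exists[OF insert(1)] by blast
  define g where "g = mode_unit V j"
  note g = mode_unit[OF V insert(2) g_def]
  note mu = matrix_unitsD[OF e(1)]
  define f where "f A C = e (A - {j}) (C - {j}) * g (j \<in> A) (j \<in> C)" for A C
  have e_alg: "e p q \<in> alg K" if "p \<in> Pow K" "q \<in> Pow K" for p q
    using units_span_base[OF that, of e] e(2) by simp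
  have P: "A - {j} \<in> Pow K" if "A \<in> Pow (insert j K)" for A
    using that by auto
  have f_mult: "f A C * f D F = (if C = D then f A F else 0)"
    if "A \<in> Pow (insert j K)" "C \<in> Pow (insert j K)" "D \<in> Pow (insert j K)" "F \<in> Pow (insert j K)"
    for A C D F
  proof -
    have "f A C * f D F = e (A - {j}) (C - {j}) * (g (j \<in> A) (j \<in> C) * e (D - {j}) (F - {j}))
        * g (j \<in> D) (j \<in> F)"
      by (simp add: f_def mult.assoc)
    also have "\<dots> = (e (A - {j}) (C - {j}) * e (D - {j}) (F - {j}))
        * (g (j \<in> A) (j \<in> C) * g (j \<in> D) (j \<in> F))"
      unfolding g(5)[OF e_alg[OF P[OF that(3)] P[OF that(4)]]] by (simp add: mult.assoc)
    also have "\<dots> = (if C - {j} = D - {j} \<and> (j \<in> C) = (j \<in> D) then f A F else 0)"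
      unfolding mu(2)[OF P[OF that(1)] P[OF that(2)] P[OF that(3)] P[OF that(4)]] g(1)
      by (simp add: f_def)
    also have "C - {j} = D - {j} \<and> (j \<in> C) = (j \<in> D) \<longleftrightarrow> C = D"
      by auto
    finally show ?thesis .
  qed
  have f_star: "star (f A C) = f C A" if "A \<in> Pow (insert j K)" "C \<in> Pow (insert j K)" for A C
    by (simp only: f_def star_mult g(2) mu(3)[OF P[OF that(1)] P[OF that(2)]]
        g(5)[OF e_alg[OF P[OF that(2)] P[OF that(1)]]])
  have split: "x * g True True + x * g False False = x" for x
    using g(3) by (metis distrib_left mult.right_neutral)
  \<comment> \<open>Summing over the level of the new mode recovers the old unit, so
    \<open>alg K\<close> lies in the span of the new units.\<close>
  have f_split: "e p q = f (insert j p) (insert j q) + f p q" if "p \<in> Pow K" "q \<in> Pow K" for p q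
  proof -
    have "j \<notin> p" "j \<notin> q"
      using that insert(2) by auto
    then show ?thesis
      by (simp add: f_def split)
  qed
  have "(\<Sum>A\<in>Pow (insert j K). f A A) = (\<Sum>A\<in>Pow K. f A A) + (\<Sum>A\<in>insert j ` Pow K. f A A)"
    unfolding Pow_insert using insert(1,2) by (intro sum.union_disjoint) auto
  also have "(\<Sum>A\<in>insert j ` Pow K. f A A) = (\<Sum>A\<in>Pow K. f (insert j A) (insert j A))"
    using insert(2) by (intro sum.reindex_cong[OF _ refl refl] inj_onI) (metis PowD insert_ident subsetD)
  also have "(\<Sum>A\<in>Pow K. f A A) + (\<Sum>A\<in>Pow K. f (insert j A) (insert j A)) = (\<Sum>A\<in>Pow K. e A A)"
    unfolding sum.distrib[symmetric] by (intro sum.cong) (auto simp: f_split add.commute)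
  finally have f_sum: "(\<Sum>A\<in>Pow (insert j K). f A A) = 1"
    using mu(4) by simp
  have f: "matrix_units (Pow (insert j K)) f"
    using f_mult f_star f_sum insert(1) unfolding matrix_units_def by auto
  note F = star_subalgebraD[OF star_subalgebra_units_span[OF f]]
  have "units_span (Pow K) e \<subseteq> units_span (Pow (insert j K)) f"
    unfolding units_span_def[of "Pow K"]
  proof (intro cvec.span_minimal F(1) subsetI)
    fix x assume "x \<in> (\<lambda>(p, q). e p q) ` (Pow K \<times> Pow K)"
    then show "x \<in> units_span (Pow (insert j K)) f"
      by (auto simp: f_split intro!: F(4) units_span_base)
  qed
  then have K_sub: "alg K \<subseteq> units_span (Pow (insert j K)) f"
    by (simp add: e(2))
  \<comment> \<open>Dually, summing over the diagonal of the old factor recovers the unit of the new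
    mode, and \<open>V\<close> times it is \<open>a j\<close>.\<close>
  have "g True False = (\<Sum>p\<in>Pow K. f (insert j p) p)"
  proof -
    have "(\<Sum>p\<in>Pow K. f (insert j p) p) = (\<Sum>p\<in>Pow K. e p p * g True False)"
    proof (intro sum.cong refl)
      fix p assume "p \<in> Pow K"
      then have "j \<notin> p"
        using insert(2) by auto
      then show "f (insert j p) p = e p p * g True False"
        by (simp add: f_def)
    qed
    then show ?thesis
      using mu(4) by (simp flip: sum_distrib_right)
  qed
  then have "g True False \<in> units_span (Pow (insert j K)) f"
    by (auto intro!: F(10) units_span_base)
  then have aj: "a j \<in> units_span (Pow (insert j K)) f"
    using F(8)[of V "g True False"] K_sub parity_opD(1)[OF V] g(4) by auto
  have "units_span (Pow (insert j K)) f = alg (insert j K)"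
  proof
    have "f A C \<in> alg (insert j K)" if "A \<in> Pow (insert j K)" "C \<in> Pow (insert j K)" for A C
    proof -
      have "e (A - {j}) (C - {j}) \<in> alg (insert j K)"
        using e_alg[OF P[OF that(1)] P[OF that(2)]] alg_mono[of K "insert j K"] by auto
      then show ?thesis
        unfolding f_def using g(6) by (rule algI)
    qed
    then show "units_span (Pow (insert j K)) f \<subseteq> alg (insert j K)"
      unfolding units_span_def by (intro cvec.span_minimal algI) auto
    show "alg (insert j K) \<subseteq> units_span (Pow (insert j K)) f"
      unfolding alg_def[of "insert j K"]
    proof (intro star_alg_generated_minimal star_subalgebra_units_span f image_subsetI)
      fix k assume "k \<in> insert j K"
      then show "a k \<in> units_span (Pow (insert j K)) f"
        using aj K_sub gen_in_alg by blast
    qed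
  qed
  then show ?case
    using f by blast
qed

text \<open>Normal ordering: factors from \<open>alg L\<close> can be moved to the right of factors
  from \<open>alg K\<close>, so the span of ordered products is closed under multiplication and
  star.\<close>

lemma span_products_alg:
  assumes K: "finite K" and L: "L \<inter> K = {}"
  shows "cvec.span {x * y |x y. x \<in> alg K \<and> y \<in> alg L} = alg (K \<union> L)"
    (is "cvec.span ?P = _")
proof
  have sub: "alg K \<subseteq> alg (K \<union> L)" "alg L \<subseteq> alg (K \<union> L)"
    by (auto intro!: alg_mono)
  then show "cvec.span ?P \<subseteq> alg (K \<union> L)"
    by (intro cvec.span_minimal algI) (auto intro!: algI)
  obtain V where V: "parity_op K V"
    using parity_op_exists[OF K] by blast
  have base: "x * y \<in> cvec.span ?P" if "x \<in> alg K" "y \<in> alg L" for x y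
    using that by (intro cvec.span_base) auto
  \<comment> \<open>The even part of \<open>y\<close> commutes with \<open>x\<close>; moving the odd
    part past \<open>x\<close> conjugates \<open>x\<close> by \<open>V\<close>, that is, applies
    \<open>\<Theta>\<close> to it.\<close>
  have swap: "y * x = x * ev y + V * x * V * od y" if "x \<in> alg K" "y \<in> alg L" for x y
  proof -
    have y: "twist V y = ev y + V * od y" "od y * V = V * od y"
      using parity_opD(6)[OF V ev_od_in_alg(2)[OF that(2)] L] by (auto simp: twist_def)
    have evc: "ev y * x = x * ev y"
      using twist_commute[OF V L that(1) ev_od_in_alg(1)[OF that(2)]]
      by (simp add: twist_def ev_eq od_eq \<Theta>_ev)
    have "V * od y * x = x * V * od y"
      using twist_commute[OF V L that(1) ev_od_in_alg(2)[OF that(2)]] ev_od_unique[of 0 "od y"]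
      by (simp add: twist_def \<Theta>_od mult.assoc)
    then have "V * (V * od y * x) = V * (x * V * od y)"
      by simp
    then have "od y * x = V * x * V * od y"
      using parity_opD(3)[OF V] by (simp flip: mult.assoc)
    then show ?thesis
      using evc ev_od[of y] by (metis distrib_right)
  qed
  have swap_in: "u * (y * x) * z \<in> cvec.span ?P"
    if "x \<in> alg K" "y \<in> alg L" "u \<in> alg K" "z \<in> alg L" for x y u z
  proof -
    have eq: "u * (y * x) * z = (u * x) * (ev y * z) + (u * (V * x * V)) * (od y * z)"
      by (simp add: swap[OF that(1,2)] algebra_simps)
    show ?thesis
      unfolding eq using that parity_opD(1)[OF V]
      by (intro cvec.span_add base algI ev_od_in_alg)
  qed
  have "star_subalgebra (cvec.span ?P)"
  proof (rule star_subalgebra_spanI)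
    show "1 \<in> cvec.span ?P"
      using base[of 1 1] algI(2) by simp
  next
    fix x y assume "x \<in> ?P" "y \<in> ?P"
    then show "x * y \<in> cvec.span ?P"
      using swap_in by (auto simp: mult.assoc)
  next
    fix x assume "x \<in> ?P"
    then obtain u y where *: "x = u * y" "u \<in> alg K" "y \<in> alg L"
      by blast
    then show "star x \<in> cvec.span ?P"
      using swap_in[of "star u" "star y" 1 1] by (simp add: star_mult algI)
  qed
  moreover have "a j \<in> cvec.span ?P" if "j \<in> K \<union> L" for j
    using that base[of "a j" 1] base[of 1 "a j"] by (auto simp: algI gen_in_alg)
  ultimately show "alg (K \<union> L) \<subseteq> cvec.span ?P"
    unfolding alg_def[of "K \<union> L"] by (intro star_alg_generated_minimal) auto
qed

end

section \<open>Ordered products of local bases\<close>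

context fermi
begin

text \<open>Inserting \<open>V * V = 1\<close> before the odd part of \<open>y\<close> turns a
  product into a sum of products whose right factors are Klein transforms, hence commute with
  \<open>alg K\<close> when \<open>y\<close> belongs to other modes.\<close>

lemma twist_expand:
  assumes "parity_op K V"
  shows "x * y = x * ev y + x * V * (V * od y)" "twist V (ev y) = ev y" "twist V (od y) = V * od y"
proof -
  have "x * V * (V * od y) = x * (V * V) * od y"
    by (simp add: mult.assoc)
  then show "x * y = x * ev y + x * V * (V * od y)"
    by (simp add: parity_opD(3)[OF assms] ev_od flip: distrib_left)
  show "twist V (ev y) = ev y" "twist V (od y) = V * od y"
    using ev_od_unique[of 0 "od y"] by (simp_all add: twist_def ev_eq od_eq \<Theta>_ev \<Theta>_od)
qed

text \<open>This is the coordinate functional at \<open>b\<close> tensored with the identity on the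
  right factor. It makes products of independent sets independent.\<close>

lemma coordinate_map:
  assumes K: "finite K" and L: "L \<inter> K = {}" and X: "linear_basis X (alg K)"
  shows "\<exists>R. (\<forall>u v. R (u + v) = R u + R v) \<and> (\<forall>c u. R (c *\<^sub>C u) = c *\<^sub>C R u)
    \<and> (\<forall>x\<in>alg K. \<forall>y\<in>alg L. R (x * y) = cvec.representation X x b *\<^sub>C y)"
proof -
  obtain V where V: "parity_op K V"
    using parity_op_exists[OF K] by blast
  obtain e where e: "matrix_units (Pow K) e" "units_span (Pow K) e = alg K"
    using matrix_units_exist[OF K] by blast
  define U where "U = Pow K"
  note e = e[folded U_def]
  define g where "g x = cvec.representation X x b" for x
  have X': "cvec.independent X" "cvec.span X = alg K"
    using X by (simp_all add: linear_basis_def)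
  have e_alg: "e p q \<in> alg K" if "p \<in> U" "q \<in> U" for p q
    using units_span_base[OF that, of e] e(2) by simp
  have g_sum: "g (\<Sum>i\<in>I. f i) = (\<Sum>i\<in>I. g (f i))" if "\<And>i. i \<in> I \<Longrightarrow> f i \<in> alg K" for I and f :: "nat set \<Rightarrow> 'a"
    using cvec.representation_sum[OF X'(1), of I f] that by (simp add: g_def X'(2))
  have g_scale: "g (c *\<^sub>C x) = c * g x" if "x \<in> alg K" for c x
    using cvec.representation_scale[OF X'(1), of x c] that by (simp add: g_def X'(2))
  have g_units: "g (x * v) = (\<Sum>p\<in>U. \<Sum>q\<in>U. c p q * g (e p q * v))"
    if "x = (\<Sum>p\<in>U. \<Sum>q\<in>U. c p q *\<^sub>C e p q)" "v \<in> alg K" for x v c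
  proof -
    have "x * v = (\<Sum>p\<in>U. \<Sum>q\<in>U. c p q *\<^sub>C (e p q * v))"
      by (simp add: that(1) sum_distrib_right scaleC_simps)
    then show ?thesis
      using that(2) e_alg by (simp add: g_sum g_scale algI)
  qed
  \<comment> \<open>On \<open>x * y\<close>, \<open>slice\<close> returns
    \<open>c p q *\<^sub>C ev y + d p q *\<^sub>C (V * od y)\<close>, with \<open>c\<close> and
    \<open>d\<close> the coefficients of \<open>x\<close> and \<open>x * V\<close>. The weight
    \<open>g (e p q * V)\<close> compensates the extra \<open>V\<close> in \<open>d\<close>, and the
    left factor \<open>V\<close> strips the Klein factor.\<close>
  define R where "R t = (\<Sum>p\<in>U. \<Sum>q\<in>U. g (e p q) *\<^sub>C ev (slice U e p q t)
      + g (e p q * V) *\<^sub>C (V * od (slice U e p q t)))" for t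
  have "R (u + v) = R u + R v" for u v
    unfolding R_def by (simp add: slice_add ev_add od_add distrib_left scaleC_add_right sum.distrib add_ac)
  moreover have "R (c *\<^sub>C u) = c *\<^sub>C R u" for c u
    unfolding R_def
    by (simp add: slice_scaleC ev_scaleC od_scaleC scaleC_simps cvec.scale_sum_right mult.commute)
  moreover have "R (x * y) = g x *\<^sub>C y" if x: "x \<in> alg K" and y: "y \<in> alg L" for x y
  proof -
    obtain c where c: "x = (\<Sum>p\<in>U. \<Sum>q\<in>U. c p q *\<^sub>C e p q)"
      using units_span_coeffs[OF e(1), of x] x e(2) by blast
    have xV: "x * V \<in> alg K"
      using x parity_opD(1)[OF V] by (rule algI)
    obtain d where d: "x * V = (\<Sum>p\<in>U. \<Sum>q\<in>U. d p q *\<^sub>C e p q)"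
      using units_span_coeffs[OF e(1), of "x * V"] xV e(2) by blast
    have sl: "slice U e p q (x * y) = c p q *\<^sub>C ev y + d p q *\<^sub>C (V * od y)"
      if "p \<in> U" "q \<in> U" for p q
    proof -
      have comm: "twist V z * e r s = e r s * twist V z" if "r \<in> U" "s \<in> U" "z \<in> alg L" for r s z
        by (rule twist_commute[OF V L e_alg[OF that(1,2)] that(3)])
      have "slice U e p q (x * twist V (ev y)) = c p q *\<^sub>C twist V (ev y)"
        using that comm ev_od_in_alg[OF y] by (intro slice_units[OF e(1) c]) auto
      moreover have "slice U e p q (x * V * twist V (od y)) = d p q *\<^sub>C twist V (od y)"
        using that comm ev_od_in_alg[OF y] by (intro slice_units[OF e(1) d]) auto
      ultimately show ?thesis
        by (subst twist_expand(1)[OF V]) (simp add: slice_add twist_expand(2,3)[OF V])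
    qed
    have ev': "ev (c *\<^sub>C ev y + d *\<^sub>C (V * od y)) = c *\<^sub>C ev y"
      and od': "od (c *\<^sub>C ev y + d *\<^sub>C (V * od y)) = d *\<^sub>C (V * od y)" for c d
      by (rule ev_od_unique; simp add: \<Theta>_simps \<Theta>_ev \<Theta>_od parity_opD(4)[OF V])+
    have VV: "V * (V * z) = z" for z
      using parity_opD(3)[OF V] by (simp flip: mult.assoc)
    have "R (x * y) = (\<Sum>p\<in>U. \<Sum>q\<in>U. (c p q * g (e p q * 1)) *\<^sub>C ev y)
        + (\<Sum>p\<in>U. \<Sum>q\<in>U. (d p q * g (e p q * V)) *\<^sub>C od y)"
      unfolding R_def by (simp add: sl ev' od' VV scaleC_simps sum.distrib mult.commute)
    also have "\<dots> = g (x * 1) *\<^sub>C ev y + g (x * V * V) *\<^sub>C od y"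
      unfolding g_units[OF c algI(2)] g_units[OF d parity_opD(1)[OF V]]
      by (simp add: cvec.scale_sum_left)
    also have "x * V * V = x"
      by (simp add: mult.assoc parity_opD(3)[OF V])
    finally show ?thesis
      by (simp add: ev_od flip: scaleC_add_right)
  qed
  ultimately show ?thesis
    unfolding g_def by blast
qed

text \<open>The coordinate map at \<open>x\<close> sends a vanishing combination of products to a
  combination of the right factors paired with \<open>x\<close>, where independence of
  \<open>Y\<close> applies. Injectivity uses the same map, and generation is
  \<open>span_products_alg\<close>.\<close>

lemma product_basis:
  assumes K: "finite K" and L: "L \<inter> K = {}"
    and X: "linear_basis X (alg K)" and Y: "linear_basis Y (alg L)"
  shows "inj_on (\<lambda>(x, y). x * y) (X \<times> Y)"
    and "linear_basis ((\<lambda>(x, y). x * y) ` (X \<times> Y)) (alg (K \<union> L))"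
proof -
  have X': "cvec.independent X" "cvec.span X = alg K"
    and Y': "cvec.independent Y" "cvec.span Y = alg L"
    using X Y by (simp_all add: linear_basis_def)
  have XK: "x \<in> alg K" if "x \<in> X" for x
    using cvec.span_base[OF that] X' by simp
  have YL: "y \<in> alg L" if "y \<in> Y" for y
    using cvec.span_base[OF that] Y' by simp
  have Y0: "y \<noteq> 0" if "y \<in> Y" for y
    using cvec.dependent_zero Y'(1) that by blast
  have "\<forall>b. \<exists>R. (\<forall>u v. R (u + v) = R u + R v) \<and> (\<forall>c u. R (c *\<^sub>C u) = c *\<^sub>C R u)
    \<and> (\<forall>x\<in>alg K. \<forall>y\<in>alg L. R (x * y) = cvec.representation X x b *\<^sub>C y)"
    using coordinate_map[OF K L X] by blast
  then obtain R where R: "\<And>b u v. R b (u + v) = R b u + R b v" "\<And>b c u. R b (c *\<^sub>C u) = c *\<^sub>C R b u"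
    "\<And>b x y. x \<in> alg K \<Longrightarrow> y \<in> alg L \<Longrightarrow> R b (x * y) = cvec.representation X x b *\<^sub>C y"
    by metis
  have R_zero: "R b 0 = 0" for b
    using R(2)[of b 0 0] by simp
  have R_sum: "R b (\<Sum>i\<in>I. f i) = (\<Sum>i\<in>I. R b (f i))" for b I and f :: "'a \<Rightarrow> 'a"
    by (induction I rule: infinite_finite_induct) (simp_all add: R(1) R_zero)
  have R_basis: "R b (x * y) = (if x = b then y else 0)" if "x \<in> X" "y \<in> Y" for b x y
    using that cvec.representation_basis[OF X'(1), of x]
    by (auto simp: R(3)[OF XK YL])
  show inj: "inj_on (\<lambda>(x, y). x * y) (X \<times> Y)"
  proof (intro inj_onI, clarify)
    fix x y x' y' assume *: "x \<in> X" "y \<in> Y" "x' \<in> X" "y' \<in> Y" "x * y = x' * y'"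
    then have "y = (if x' = x then y' else 0)"
      using R_basis[of x y x] R_basis[of x' y' x] by simp
    then show "x = x' \<and> y = y'"
      using Y0[OF *(2)] by (auto split: if_splits)
  qed
  have ind: "cvec.independent ((\<lambda>(x, y). x * y) ` (X \<times> Y))"
    unfolding cvec.dependent_explicit
  proof clarsimp
    fix t u v assume t: "finite t" "t \<subseteq> (\<lambda>(x, y). x * y) ` (X \<times> Y)" "(\<Sum>v\<in>t. u v *\<^sub>C v) = 0"
      and v: "v \<in> t"
    obtain x y where xy: "v = x * y" "x \<in> X" "y \<in> Y"
      using t(2) v by auto
    \<comment> \<open>The right factors paired with \<open>x\<close> in \<open>t\<close>; there are
      finitely many because left multiplication by \<open>x\<close> is injective on them.\<close>
    define T where "T = {z\<in>Y. x * z \<in> t}"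
    have injx: "inj_on ((*) x) T"
      using inj xy(2) by (auto simp: inj_on_def T_def)
    have T: "finite T"
      using finite_subset[OF _ t(1), of "(*) x ` T"] injx finite_imageD by (force simp: T_def)
    have "0 = (\<Sum>v\<in>t. u v *\<^sub>C R x v)"
      using arg_cong[OF t(3), of "R x"] by (simp add: R_sum R(2) R_zero)
    also have "\<dots> = (\<Sum>v\<in>(*) x ` T. u v *\<^sub>C R x v)"
    proof (rule sum.mono_neutral_right[OF t(1)])
      show "(*) x ` T \<subseteq> t"
        by (auto simp: T_def)
      show "\<forall>i\<in>t - (*) x ` T. u i *\<^sub>C R x i = 0"
      proof
        fix i assume i: "i \<in> t - (*) x ` T"
        then obtain x' y' where "i = x' * y'" "x' \<in> X" "y' \<in> Y"
          using t(2) by auto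
        then show "u i *\<^sub>C R x i = 0"
          using i R_basis[of x' y' x] by (auto simp: T_def)
      qed
    qed
    also have "\<dots> = (\<Sum>z\<in>T. u (x * z) *\<^sub>C R x (x * z))"
      by (simp add: sum.reindex[OF injx])
    also have "\<dots> = (\<Sum>z\<in>T. u (x * z) *\<^sub>C z)"
      by (intro sum.cong) (auto simp: T_def R_basis[OF xy(2)])
    finally have "u (x * y) = 0"
      using cvec.independentD[OF Y'(1) T, of "\<lambda>z. u (x * z)" y] v xy by (auto simp: T_def)
    then show "u v = 0"
      by (simp add: xy(1))
  qed
  have "cvec.span ((\<lambda>(x, y). x * y) ` (X \<times> Y)) = alg (K \<union> L)" (is "cvec.span ?Z = _")
  proof
    have sub: "alg K \<subseteq> alg (K \<union> L)" "alg L \<subseteq> alg (K \<union> L)"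
      by (auto intro!: alg_mono)
    show "cvec.span ?Z \<subseteq> alg (K \<union> L)"
      using sub XK YL by (intro cvec.span_minimal algI) (auto intro!: algI)
    have XY: "x * y \<in> cvec.span ?Z" if "x \<in> alg K" "y \<in> Y" for x y
    proof -
      have "x \<in> cvec.span X" using that X' by simp
      then show ?thesis
      proof (induction rule: cvec.span_induct_alt)
        case base
        show ?case by (simp add: cvec.span_zero)
      next
        case (step c w x)
        then show ?case
          using that(2) unfolding distrib_right mult_scaleC_left
          by (intro cvec.span_add cvec.span_scale) (auto intro!: cvec.span_base)
      qed
    qed
    have "x * y \<in> cvec.span ?Z" if "x \<in> alg K" "y \<in> cvec.span Y" for x y
      using that(2)
    proof (induction rule: cvec.span_induct_alt)
      case base
      show ?case by (simp add: cvec.span_zero)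
    next
      case (step c w y)
      then show ?case
        using XY[OF that(1)] unfolding distrib_left mult_scaleC_right
        by (intro cvec.span_add cvec.span_scale) auto
    qed
    then show "alg (K \<union> L) \<subseteq> cvec.span ?Z"
      unfolding span_products_alg[OF K L, symmetric] using Y'(2)
      by (intro cvec.span_minimal) auto
  qed
  with ind show "linear_basis ?Z (alg (K \<union> L))"
    by (simp add: linear_basis_def)
qed

text \<open>\<open>alg K\<close> is spanned by finitely many matrix units. Finiteness matters
  because \<open>extended_expectation\<close> sums over all tuples from the bases, and a sum over an
  infinite set is zero by convention.\<close>

lemma finite_linear_basis:
  assumes "finite K" "linear_basis X (alg K)"
  shows "finite X"
proof -
  obtain e where e: "matrix_units (Pow K) e" "units_span (Pow K) e = alg K"
    using matrix_units_exist[OF assms(1)] by blast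
  have "X \<subseteq> cvec.span ((\<lambda>(p, q). e p q) ` (Pow K \<times> Pow K))"
    using assms(2) cvec.span_superset[of X] e(2) by (simp add: linear_basis_def units_span_def)
  moreover have "finite ((\<lambda>(p, q). e p q) ` (Pow K \<times> Pow K))"
    using assms(1) by simp
  ultimately show ?thesis
    using cvec.independent_span_bound assms(2) by (auto simp: linear_basis_def)
qed

lemma linear_basis_one: "linear_basis {1} (alg {})"
proof -
  have "star_subalgebra (cvec.span {1 :: 'a})"
    by (rule star_subalgebra_spanI) (auto intro: cvec.span_base)
  then have "alg {} \<subseteq> cvec.span {1}"
    unfolding alg_def by (intro star_alg_generated_minimal) auto
  moreover have "cvec.span {1} \<subseteq> alg {}"
    by (intro cvec.span_minimal algI) (auto intro: algI)
  ultimately show ?thesis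
    by (auto simp: linear_basis_def)
qed

section \<open>Bases of ordered products\<close>

lemma ordered_product_Suc: "ordered_product e (Suc N) = ordered_product e N * e N"
  by (simp add: ordered_product_def)

lemma ordered_product_cong:
  assumes "\<And>k. k < N \<Longrightarrow> e k = e' k"
  shows "ordered_product e N = ordered_product e' N"
proof -
  have "map e [0..<N] = map e' [0..<N]"
    using assms by simp
  then show ?thesis
    by (simp only: ordered_product_def)
qed

text \<open>Induction on the number of blocks with \<open>product_basis\<close>. Injectivity is
  included because \<open>extended_expectation\<close> sums over tuples, so each product must come
  from only one of them.\<close>

lemma ordered_product_basis:
  assumes J: "\<And>m. finite (J m)" "disjoint_family J" and B: "\<And>m. linear_basis (B m) (alg (J m))"
  shows "inj_on (\<lambda>e. ordered_product e N) (\<Pi>\<^sub>E k\<in>{..<N}. B k)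
    \<and> linear_basis (ordered_basis B N) (alg (\<Union>m<N. J m))"
proof (induction N)
  case 0
  show ?case
    using linear_basis_one by (simp add: ordered_basis_def ordered_product_def)
next
  case (Suc N)
  have fin: "finite (\<Union>m<N. J m)"
    using J(1) by simp
  have "J N \<inter> J m = {}" if "m < N" for m
    using that by (intro disjoint_family_onD[OF J(2)]) auto
  then have disj: "J N \<inter> (\<Union>m<N. J m) = {}"
    by blast
  have union: "(\<Union>m<N. J m) \<union> J N = (\<Union>m<Suc N. J m)"
    by (auto simp: lessThan_Suc)
  note pb = product_basis[OF fin disj conjunct2[OF Suc] B, unfolded union]
  \<comment> \<open>Tuples are extensional functions, so the first \<open>N\<close> entries must be
    isolated by \<open>restrict\<close> before the induction hypothesis applies.\<close>
  have restr: "restrict e {..<N} \<in> (\<Pi>\<^sub>E k\<in>{..<N}. B k)" "e N \<in> B N"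
    "ordered_product (restrict e {..<N}) N = ordered_product e N"
    if "e \<in> (\<Pi>\<^sub>E k\<in>{..<Suc N}. B k)" for e
  proof -
    show "restrict e {..<N} \<in> (\<Pi>\<^sub>E k\<in>{..<N}. B k)" "e N \<in> B N"
      using that by (auto simp: PiE_iff)
    show "ordered_product (restrict e {..<N}) N = ordered_product e N"
      by (rule ordered_product_cong) simp
  qed
  have mem: "ordered_product e N \<in> ordered_basis B N" if "e \<in> (\<Pi>\<^sub>E k\<in>{..<Suc N}. B k)" for e
    unfolding ordered_basis_def
    by (rule image_eqI[where x = "restrict e {..<N}"]) (use restr[OF that] in simp_all)
  have "ordered_basis B (Suc N) = (\<lambda>(x, y). x * y) ` (ordered_basis B N \<times> B N)"
  proof (intro equalityI subsetI)
    fix x assume "x \<in> ordered_basis B (Suc N)"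
    then obtain e where e: "x = ordered_product e N * e N" "e \<in> (\<Pi>\<^sub>E k\<in>{..<Suc N}. B k)"
      by (auto simp: ordered_basis_def ordered_product_Suc)
    show "x \<in> (\<lambda>(x, y). x * y) ` (ordered_basis B N \<times> B N)"
      by (rule image_eqI[where x = "(ordered_product e N, e N)"])
        (use e mem[OF e(2)] restr(2)[OF e(2)] in simp_all)
  next
    fix x assume "x \<in> (\<lambda>(x, y). x * y) ` (ordered_basis B N \<times> B N)"
    then obtain e y where e: "x = ordered_product e N * y" "e \<in> (\<Pi>\<^sub>E k\<in>{..<N}. B k)" "y \<in> B N"
      by (auto simp: ordered_basis_def)
    have "ordered_product (e(N := y)) N = ordered_product e N"
      by (rule ordered_product_cong) simp
    then have "x = ordered_product (e(N := y)) (Suc N)"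
      using e by (simp add: ordered_product_Suc)
    moreover have "e(N := y) \<in> (\<Pi>\<^sub>E k\<in>{..<Suc N}. B k)"
      using e by (auto simp: PiE_iff extensional_def less_Suc_eq)
    ultimately show "x \<in> ordered_basis B (Suc N)"
      unfolding ordered_basis_def by blast
  qed
  moreover have "inj_on (\<lambda>e. ordered_product e (Suc N)) (\<Pi>\<^sub>E k\<in>{..<Suc N}. B k)"
  proof (rule inj_onI)
    fix e e' assume e: "e \<in> (\<Pi>\<^sub>E k\<in>{..<Suc N}. B k)" and e': "e' \<in> (\<Pi>\<^sub>E k\<in>{..<Suc N}. B k)"
      and eq: "ordered_product e (Suc N) = ordered_product e' (Suc N)"
    have "ordered_product e N = ordered_product e' N \<and> e N = e' N"
      using inj_onD[OF pb(1), of "(ordered_product e N, e N)" "(ordered_product e' N, e' N)"]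
        eq mem[OF e] mem[OF e'] restr(2)[OF e] restr(2)[OF e'] by (simp add: ordered_product_Suc)
    moreover from this have "restrict e {..<N} = restrict e' {..<N}"
      by (intro inj_onD[OF conjunct1[OF Suc] _ restr(1)[OF e] restr(1)[OF e']])
        (simp only: restr(3)[OF e] restr(3)[OF e'])
    ultimately have "e k = e' k" if "k < Suc N" for k
      using that by (metis less_Suc_eq lessThan_iff restrict_apply')
    then show "e = e'"
      using e e' by (intro PiE_ext[of e "{..<Suc N}" B e']) auto
  qed
  ultimately show ?case
    using pb(2) by simp
qed

end

section \<open>Complete positivity\<close>

lemma linear_map_on_sum:
  assumes "linear_map_on D S P" "cvec.subspace D" "\<And>i. i \<in> I \<Longrightarrow> f i \<in> D"
  shows "P (\<Sum>i\<in>I. f i) = (\<Sum>i\<in>I. P (f i))"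
proof -
  have zero: "P 0 = 0"
  proof -
    have "P (0 *\<^sub>C 0) = 0 *\<^sub>C P 0"
      using assms(1) cvec.subspace_0[OF assms(2)] unfolding linear_map_on_def by blast
    then show ?thesis by simp
  qed
  show ?thesis
    using assms(3)
  proof (induction I rule: infinite_finite_induct)
    case (insert i I)
    then have "f i \<in> D" "sum f I \<in> D"
      by (auto intro: cvec.subspace_sum[OF assms(2)])
    then have "P (f i + sum f I) = P (f i) + P (sum f I)"
      using assms(1) unfolding linear_map_on_def by blast
    then show ?case
      using insert by simp
  qed (simp_all add: zero)
qed

lemma linear_maps_agree_on_span:
  assumes F: "linear_map_on D S F" and G: "linear_map_on D T G" and D: "cvec.subspace D" "X \<subseteq> D"
    and eq: "\<And>x. x \<in> X \<Longrightarrow> F x = G x" and x: "x \<in> cvec.span X"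
  shows "F x = G x"
proof -
  have "cvec.subspace {x \<in> D. F x = G x}"
  proof (rule cvec.subspaceI)
    show "0 \<in> {x \<in> D. F x = G x}"
      using linear_map_on_sum[OF F D(1), of "{}"] linear_map_on_sum[OF G D(1), of "{}"]
        cvec.subspace_0[OF D(1)] by simp
  qed (use F G D(1) in \<open>auto simp: linear_map_on_def cvec.subspace_def\<close>)
  then show ?thesis
    using cvec.span_minimal[of X "{x \<in> D. F x = G x}"] D(2) eq x by blast
qed

text \<open>Every diagonal unit contains \<open>e u u\<close> as a factor, so if
  \<open>e u u\<close> vanished, the unit of the algebra would vanish.\<close>

lemma matrix_unit_nonzero:
  assumes "matrix_units U e" "u \<in> U"
  shows "e u u \<noteq> 0"
proof
  note mu = matrix_unitsD[OF assms(1)]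
  assume z: "e u u = 0"
  have "e p p = 0" if "p \<in> U" for p
  proof -
    have "e p u * e u u * e u p = e p p"
      using that assms(2) by (simp add: mu)
    then show ?thesis by (simp add: z)
  qed
  then show False
    using mu(4) by simp
qed

text \<open>Compression to the corner \<open>e u u\<close> turns each summand
  \<open>star (c k) * c k\<close> into a sum of squared moduli times \<open>e u u\<close>, and
  \<open>e u u\<close> is not zero.\<close>

lemma positive_matrix_unit_scalar:
  assumes e: "matrix_units U e" and u: "u \<in> U" and pos: "positive_in (units_span U e) (s *\<^sub>C e u u)"
  shows "s \<in> complex_of_real ` {0..}"
proof -
  note mu = matrix_unitsD[OF e]
  obtain m c where c: "\<forall>k<(m::nat). c k \<in> units_span U e" "s *\<^sub>C e u u = (\<Sum>k<m. star (c k) * c k)"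
    using pos unfolding positive_in_def by blast
  have "\<exists>d. \<forall>v\<in>U. e u v * c k * e u u = d v *\<^sub>C e u u" if "k < m" for k
  proof -
    obtain d where d: "c k = (\<Sum>p\<in>U. \<Sum>q\<in>U. d p q *\<^sub>C e p q)"
      using units_span_coeffs[OF e] c(1) \<open>k < m\<close> by blast
    show ?thesis
      using units_sandwich[OF e d _ u u u] by (intro exI[of _ "\<lambda>v. d v u"]) auto
  qed
  then obtain d where d: "\<And>k v. k < m \<Longrightarrow> v \<in> U \<Longrightarrow> e u v * c k * e u u = d k v *\<^sub>C e u u"
    by metis
  have sq: "e u u * (star (c k) * c k) * e u u = (\<Sum>v\<in>U. (cnj (d k v) * d k v) *\<^sub>C e u u)"
    if "k < m" for k
  proof -
    \<comment> \<open>The unit is inserted between \<open>star (c k)\<close> and \<open>c k\<close>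
      as a sum of \<open>e v u * e u v\<close>, which splits the compression into the scalar entries
      of one column.\<close>
    have "e u u * (star (c k) * c k) * e u u
        = e u u * (star (c k) * (\<Sum>v\<in>U. e v u * e u v) * c k) * e u u"
    proof -
      have "(\<Sum>v\<in>U. e v u * e u v) = (\<Sum>v\<in>U. e v v)"
        using u by (intro sum.cong) (simp_all add: mu)
      then show ?thesis
        using mu(4) by (simp add: mult.assoc)
    qed
    also have "\<dots> = (\<Sum>v\<in>U. star (e u v * c k * e u u) * (e u v * c k * e u u))"
    proof -
      have "star (e u v * c k * e u u) = e u u * star (c k) * e v u" if "v \<in> U" for v
        using u that by (simp add: star_mult mu mult.assoc)
      then show ?thesis
        by (simp add: sum_distrib_left sum_distrib_right mult.assoc cong: sum.cong)
    qed
    also have "\<dots> = (\<Sum>v\<in>U. (cnj (d k v) * d k v) *\<^sub>C e u u)"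
      using u by (intro sum.cong) (simp_all add: d[OF that] scaleC_simps mu)
    finally show ?thesis .
  qed
  have "s *\<^sub>C e u u = e u u * (s *\<^sub>C e u u) * e u u"
    using u by (simp add: scaleC_simps mu)
  also have "\<dots> = (\<Sum>k<m. \<Sum>v\<in>U. (cnj (d k v) * d k v) *\<^sub>C e u u)"
    unfolding c(2) by (simp add: sum_distrib_left sum_distrib_right sq)
  also have "\<dots> = (\<Sum>k<m. \<Sum>v\<in>U. cnj (d k v) * d k v) *\<^sub>C e u u"
    by (simp add: cvec.scale_sum_left)
  finally have "s = (\<Sum>k<m. \<Sum>v\<in>U. cnj (d k v) * d k v)"
    using matrix_unit_nonzero[OF e u] by simp
  also have "\<dots> = of_real (\<Sum>k<m. \<Sum>v\<in>U. (cmod (d k v))\<^sup>2)"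
    by (simp add: complex_norm_square mult.commute del: of_real_power)
  finally have "s = of_real (\<Sum>k<m. \<Sum>v\<in>U. (cmod (d k v))\<^sup>2)" .
  moreover have "0 \<le> (\<Sum>k<m. \<Sum>v\<in>U. (cmod (d k v))\<^sup>2)"
    by (intro sum_nonneg) simp
  ultimately show ?thesis
    by blast
qed

lemma completely_positiveD:
  assumes "completely_positive D S P" "1 \<le> (m::nat)" "\<And>j. j < m \<Longrightarrow> b j \<in> S" "\<And>j. j < m \<Longrightarrow> d j \<in> D"
  shows "positive_in S (\<Sum>j<m. \<Sum>k<m. star (b j) * P (star (d j) * d k) * b k)"
  using assms unfolding completely_positive_def by simp

text \<open>A finite Kolmogorov decomposition. The coefficients of
  \<open>P (star (y i) * y j)\<close> in the units form a kernel on \<open>I\<close> times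
  \<open>U\<close>; complete positivity makes it positive, and \<open>positive_kernel_gram\<close>
  supplies the vectors.\<close>

lemma completely_positive_gram:
  assumes f: "matrix_units U f" "units_span U f = S" and P: "completely_positive D S P"
    and D: "star_subalgebra D" and I: "finite I" "\<And>i. i \<in> I \<Longrightarrow> y i \<in> D"
  shows "\<exists>N F. (\<forall>k<(N::nat). \<forall>i\<in>I. F k i \<in> S)
    \<and> (\<forall>i\<in>I. \<forall>j\<in>I. P (star (y i) * y j) = (\<Sum>k<N. star (F k i) * F k j))"
proof -
  note mu = matrix_unitsD[OF f(1)]
  have "U \<noteq> {}"
    using mu(4) by auto
  then obtain u where u: "u \<in> U"
    by blast
  have PS: "P (star (y i) * y j) \<in> units_span U f" if "i \<in> I" "j \<in> I" for i j
    using P star_subalgebraD(8,9)[OF D] I(2) that f(2)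
    unfolding completely_positive_def linear_map_on_def by blast
  have "\<exists>Q. P (star (y i) * y j) = (\<Sum>v\<in>U. \<Sum>w\<in>U. Q v w *\<^sub>C f v w)" if "i \<in> I" "j \<in> I" for i j
    using units_span_coeffs[OF f(1) PS[OF that]] by blast
  then obtain Q where Q: "\<And>i j. i \<in> I \<Longrightarrow> j \<in> I \<Longrightarrow>
      P (star (y i) * y j) = (\<Sum>v\<in>U. \<Sum>w\<in>U. Q i j v w *\<^sub>C f v w)"
    by metis
  define K where "K = (\<lambda>(i, v) (j, w). Q i j v w)"
  have "(\<Sum>x\<in>I\<times>U. \<Sum>z\<in>I\<times>U. cnj (c x) * c z * K x z) \<in> complex_of_real ` {0..}" for c
  \<comment> \<open>The definition of complete positivity speaks of at least one element, so the
    empty family is treated apart.\<close>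
  proof (cases "I = {}")
    case False
    obtain h where h: "bij_betw h {..<card I} I"
      using ex_bij_betw_nat_finite[OF I(1)] by (auto simp: atLeast0LessThan)
    \<comment> \<open>All test elements are supported in the column \<open>u\<close>, so the sum in
      complete positivity collapses to a scalar multiple of \<open>f u u\<close>.\<close>
    define b where "b i = (\<Sum>v\<in>U. c (i, v) *\<^sub>C f v u)" for i
    have bS: "b i \<in> S" for i
      unfolding b_def f(2)[symmetric] using u
      by (intro star_subalgebraD[OF star_subalgebra_units_span[OF f(1)]] units_span_base) auto
    have star_b: "star (b i) = (\<Sum>v\<in>U. cnj (c (i, v)) *\<^sub>C f u v)" for i
      using u by (simp add: b_def star_sum star_scaleC mu)
    have "1 \<le> card I"
      using False I(1) by (simp add: Suc_le_eq card_gt_0_iff)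
    moreover have "y (h k) \<in> D" if "k < card I" for k
      using bij_betwE[OF h] I(2) that by auto
    ultimately have "positive_in S (\<Sum>j<card I. \<Sum>k<card I.
        star (b (h j)) * P (star (y (h j)) * y (h k)) * b (h k))"
      using bS by (intro completely_positiveD[OF P]) auto
    also have "(\<Sum>j<card I. \<Sum>k<card I. star (b (h j)) * P (star (y (h j)) * y (h k)) * b (h k))
        = (\<Sum>j<card I. \<Sum>k\<in>I. star (b (h j)) * P (star (y (h j)) * y k) * b k)"
      by (intro sum.cong refl sum.reindex_bij_betw[OF h])
    also have "\<dots> = (\<Sum>j\<in>I. \<Sum>k\<in>I. star (b j) * P (star (y j) * y k) * b k)"
      by (rule sum.reindex_bij_betw[OF h])
    also have "\<dots> = (\<Sum>i\<in>I. \<Sum>j\<in>I. \<Sum>v\<in>U. \<Sum>w\<in>U. (cnj (c (i, v)) * c (j, w) * Q i j v w) *\<^sub>C f u u)"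
    proof (intro sum.cong refl)
      fix i j assume i: "i \<in> I" and j: "j \<in> I"
      have "star (b i) * P (star (y i) * y j) * b j
          = (\<Sum>w\<in>U. \<Sum>v\<in>U. (c (j, w) * cnj (c (i, v))) *\<^sub>C (f u v * P (star (y i) * y j) * f w u))"
        unfolding star_b unfolding b_def
        by (simp add: sum_distrib_left sum_distrib_right scaleC_simps cvec.scale_sum_right)
      also have "\<dots> = (\<Sum>w\<in>U. \<Sum>v\<in>U. (cnj (c (i, v)) * c (j, w) * Q i j v w) *\<^sub>C f u u)"
        using units_sandwich[OF f(1) Q[OF i j]] u
        by (intro sum.cong refl) (simp add: scaleC_scaleC mult_ac)
      also have "\<dots> = (\<Sum>v\<in>U. \<Sum>w\<in>U. (cnj (c (i, v)) * c (j, w) * Q i j v w) *\<^sub>C f u u)"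
        by (rule sum.swap)
      finally show "star (b i) * P (star (y i) * y j) * b j
          = (\<Sum>v\<in>U. \<Sum>w\<in>U. (cnj (c (i, v)) * c (j, w) * Q i j v w) *\<^sub>C f u u)" .
    qed
    also have "\<dots> = (\<Sum>i\<in>I. \<Sum>v\<in>U. \<Sum>j\<in>I. \<Sum>w\<in>U. (cnj (c (i, v)) * c (j, w) * Q i j v w) *\<^sub>C f u u)"
      by (intro sum.cong refl sum.swap)
    also have "\<dots> = (\<Sum>x\<in>I\<times>U. \<Sum>z\<in>I\<times>U. cnj (c x) * c z * K x z) *\<^sub>C f u u"
      by (simp add: cvec.scale_sum_left sum.cartesian_product' K_def)
    finally show ?thesis
      using positive_matrix_unit_scalar[OF f(1) u] f(2) by simp
  qed auto
  from positive_kernel_gram[of "I \<times> U" K, OF _ this] obtain N and G where G: "\<forall>x\<in>I\<times>U. \<forall>z\<in>I\<times>U. K x z = (\<Sum>k<(N::nat). cnj (G k x) * G k z)"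
    using I(1) mu(1) by blast
  \<comment> \<open>The Gram vectors are placed in the row \<open>u\<close>; then
    \<open>star (f u v) * f u w = f v w\<close> returns the matrix with the kernel as
    coefficients.\<close>
  define F where "F k i = (\<Sum>w\<in>U. G k (i, w) *\<^sub>C f u w)" for k i
  have "F k i \<in> S" for k i
    unfolding F_def f(2)[symmetric] using u
    by (intro star_subalgebraD[OF star_subalgebra_units_span[OF f(1)]] units_span_base) auto
  moreover have "P (star (y i) * y j) = (\<Sum>k<N. star (F k i) * F k j)" if "i \<in> I" "j \<in> I" for i j
  proof -
    have "star (F k i) * F k j = (\<Sum>v\<in>U. \<Sum>w\<in>U. (cnj (G k (i, v)) * G k (j, w)) *\<^sub>C f v w)" for k
      unfolding F_def star_sum sum_product using u
      by (intro sum.cong refl) (simp add: scaleC_simps mu mult.commute)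
    then have "(\<Sum>k<N. star (F k i) * F k j)
        = (\<Sum>k<N. \<Sum>v\<in>U. \<Sum>w\<in>U. (cnj (G k (i, v)) * G k (j, w)) *\<^sub>C f v w)"
      by simp
    also have "\<dots> = (\<Sum>v\<in>U. \<Sum>k<N. \<Sum>w\<in>U. (cnj (G k (i, v)) * G k (j, w)) *\<^sub>C f v w)"
      by (rule sum.swap)
    also have "\<dots> = (\<Sum>v\<in>U. \<Sum>w\<in>U. \<Sum>k<N. (cnj (G k (i, v)) * G k (j, w)) *\<^sub>C f v w)"
      by (intro sum.cong refl sum.swap)
    also have "\<dots> = (\<Sum>v\<in>U. \<Sum>w\<in>U. K (i, v) (j, w) *\<^sub>C f v w)"
      using G that by (intro sum.cong refl) (simp add: cvec.scale_sum_left)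
    finally show ?thesis
      using Q[OF that] by (simp add: K_def)
  qed
  ultimately show ?thesis
    by blast
qed

text \<open>Complete positivity already forces this: for the family \<open>x, 1\<close> the two
  off-diagonal Gram entries are adjoint to each other.\<close>

lemma completely_positive_star:
  assumes f: "matrix_units U f" "units_span U f = S" and P: "completely_positive D S P"
    and D: "star_subalgebra D" and x: "x \<in> D"
  shows "P (star x) = star (P x)"
proof -
  have y: "(if i then x else 1) \<in> D" if "i \<in> (UNIV :: bool set)" for i
    using x star_subalgebraD(2)[OF D] by simp
  obtain N F where F: "\<And>i j. P (star (if i then x else 1) * (if j then x else 1))
      = (\<Sum>k<(N::nat). star (F k i) * F k j)"
    using completely_positive_gram[OF f P D, of UNIV "\<lambda>i. if i then x else 1"] y by auto
  show ?thesis
    using F[of True False] F[of False True] by (simp add: star_sum star_mult star_star)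
qed

context fermi
begin

section \<open>Even Gram vectors and matrices over the Klein image\<close>

lemma gen_sum_unitary: "(a j + star (a j)) * (a j + star (a j)) = 1"
  using car(1)[of j j] by (simp add: algebra_simps square_zero)

text \<open>Odd vectors in a Gram representation become even after multiplication by the odd
  self-adjoint unitary \<open>a j + star (a j)\<close>.\<close>

lemma even_gram:
  assumes M: "finite M" "j \<in> M" and P: "completely_positive D (alg M) P"
    and D: "star_subalgebra D" and even: "\<And>x. x \<in> D \<Longrightarrow> \<Theta> (P x) = P x"
    and I: "finite I" "\<And>i. i \<in> I \<Longrightarrow> y i \<in> D"
  shows "\<exists>(A :: (nat \<times> bool) set) F. finite A \<and> (\<forall>k\<in>A. \<forall>i\<in>I. F k i \<in> even_part \<Theta> (alg M))
    \<and> (\<forall>i\<in>I. \<forall>j\<in>I. P (star (y i) * y j) = (\<Sum>k\<in>A. star (F k i) * F k j))"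
proof -
  obtain f where f: "matrix_units (Pow M) f" "units_span (Pow M) f = alg M"
    using matrix_units_exist[OF M(1)] by blast
  obtain N F where F: "\<And>k i. k < (N::nat) \<Longrightarrow> i \<in> I \<Longrightarrow> F k i \<in> alg M"
    "\<And>i j. i \<in> I \<Longrightarrow> j \<in> I \<Longrightarrow> P (star (y i) * y j) = (\<Sum>k<N. star (F k i) * F k j)"
    using completely_positive_gram[OF f P D I(1), of y] I(2) by blast
  define w where "w = a j + star (a j)"
  have w: "star w = w" "w * w = 1" "\<Theta> w = - w" "w \<in> alg M"
    using M(2) by (simp_all add: w_def gen_sum_unitary star_add star_star \<Theta>_add \<Theta>_gen \<Theta>_star_gen
        add.commute algI gen_in_alg)
  \<comment> \<open>The Boolean selects the even or the odd part; the left factor \<open>w\<close>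
    cancels in \<open>star (H k i) * H k j\<close>.\<close>
  define H where "H = (\<lambda>(k, s) i. if s then ev (F k i) else w * od (F k i))"
  have "H k i \<in> even_part \<Theta> (alg M)" if "k \<in> {..<N} \<times> UNIV" "i \<in> I" for k i
    using that F(1) w by (auto simp: H_def even_part_def \<Theta>_ev \<Theta>_od \<Theta>_mult intro!: algI ev_od_in_alg)
  moreover have "P (star (y i) * y j) = (\<Sum>k\<in>{..<N} \<times> UNIV. star (H k i) * H k j)"
    if "i \<in> I" "j \<in> I" for i j
  proof -
    have ww: "w * (w * z) = z" for z
      using w(2) by (simp flip: mult.assoc)
    \<comment> \<open>Since the value is even, its even part may be taken, which removes the mixed
      terms of even with odd parts.\<close>
    have "P (star (y i) * y j) = ev (P (star (y i) * y j))"
      using even[of "star (y i) * y j"] I(2) that star_subalgebraD(8,9)[OF D] by (simp add: ev_eq)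
    also have "\<dots> = (\<Sum>k<N. ev (star (F k i) * F k j))"
      unfolding F(2)[OF that] by (induction N) (simp_all add: ev_add ev_eq)
    also have "\<dots> = (\<Sum>k<N. \<Sum>s\<in>UNIV. star (H (k, s) i) * H (k, s) j)"
      by (simp add: UNIV_bool H_def ev_mult ev_star od_star star_mult w(1) mult.assoc ww add.commute)
    finally show ?thesis
      by (simp add: sum.cartesian_product)
  qed
  ultimately show ?thesis
    by (intro exI[of _ "{..<N} \<times> UNIV"] exI[of _ H]) auto
qed

text \<open>Ordered products span, and \<open>twist_expand\<close> rewrites each of them with Klein
  transforms on the right; expanding the left factors in units gives the matrix entries.\<close>

lemma twist_decomposition:
  assumes V: "parity_op K V" and K: "finite K" and L: "L \<inter> K = {}"
    and e: "matrix_units U e" "units_span U e = alg K" and z: "z \<in> alg (K \<union> L)"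
  shows "\<exists>y. (\<forall>p q. y p q \<in> alg L) \<and> z = (\<Sum>p\<in>U. \<Sum>q\<in>U. e p q * twist V (y p q))"
proof -
  have "z \<in> cvec.span {x * y |x y. x \<in> alg K \<and> y \<in> alg L}"
    using z span_products_alg[OF K L] by simp
  then show ?thesis
  proof (induction rule: cvec.span_induct_alt)
    case base
    have "twist V 0 = 0"
      by (simp add: twist_def ev_eq od_eq)
    then show ?case
      by (intro exI[of _ "\<lambda>_ _. 0"]) (simp add: algI)
  next
    case (step c w z)
    from step(1) obtain x v where w: "w = x * v" "x \<in> alg K" "v \<in> alg L"
      by blast
    from step(2) obtain y where y: "\<And>p q. y p q \<in> alg L"
      "z = (\<Sum>p\<in>U. \<Sum>q\<in>U. e p q * twist V (y p q))"
      by blast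
    have xV: "x * V \<in> alg K"
      using w(2) parity_opD(1)[OF V] by (rule algI)
    obtain b where b: "x = (\<Sum>p\<in>U. \<Sum>q\<in>U. b p q *\<^sub>C e p q)"
      using units_span_coeffs[OF e(1), of x] w(2) e(2) by blast
    obtain d where d: "x * V = (\<Sum>p\<in>U. \<Sum>q\<in>U. d p q *\<^sub>C e p q)"
      using units_span_coeffs[OF e(1), of "x * V"] xV e(2) by blast
    \<comment> \<open>The even part carries the coefficients of \<open>x\<close>, the odd part those
      of \<open>x * V\<close>, because its Klein transform contains one more
      \<open>V\<close>.\<close>
    define y' where "y' p q = c *\<^sub>C (b p q *\<^sub>C ev v + d p q *\<^sub>C od v) + y p q" for p q
    have "c *\<^sub>C w = c *\<^sub>C (x * twist V (ev v) + x * V * twist V (od v))"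
      using twist_expand(1)[OF V, of x v] by (simp add: w(1) twist_expand(2,3)[OF V])
    also have "\<dots> = (\<Sum>p\<in>U. \<Sum>q\<in>U. e p q * twist V (c *\<^sub>C (b p q *\<^sub>C ev v + d p q *\<^sub>C od v)))"
      unfolding d by (subst b) (simp add: sum_distrib_right twist_scaleC twist_add distrib_left
          scaleC_simps sum.distrib cvec.scale_sum_right)
    finally have "c *\<^sub>C w + z = (\<Sum>p\<in>U. \<Sum>q\<in>U. e p q * twist V (y' p q))"
      by (simp add: y(2) y'_def twist_add distrib_left sum.distrib)
    moreover have "\<forall>p q. y' p q \<in> alg L"
      using w(3) y(1) by (auto simp: y'_def intro!: algI ev_od_in_alg)
    ultimately show ?case
      by blast
  qed
qed

end

section \<open>The extended expectation\<close>

context fermi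
begin

text \<open>The odd unitary \<open>w\<close> in \<open>alg K\<close> satisfies both
  \<open>y * w = w * y\<close> and \<open>w * y = \<Theta> y * w\<close>; cancelling
  \<open>w\<close> gives the claim.\<close>

lemma commutant_even:
  assumes k: "k \<in> K" and M: "M \<inter> K = {}" and y: "y \<in> alg M" "y \<in> commutant (alg K)"
  shows "\<Theta> y = y"
proof -
  define w where "w = a k + star (a k)"
  have ww: "w * w = 1"
    by (simp add: w_def gen_sum_unitary)
  have w: "w \<in> alg K"
    using k by (auto simp: w_def intro!: algI gen_in_alg)
  have "y * w = w * y"
    using y(2) w by (auto simp: commutant_def)
  also have "\<dots> = \<Theta> y * w"
  proof -
    have "k \<notin> M"
      using k M by blast
    then show ?thesis
      using gen_anticommute[OF y(1)] by (simp add: w_def distrib_left distrib_right)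
  qed
  finally have "y * w * w = \<Theta> y * w * w"
    by simp
  then show ?thesis
    by (simp add: mult.assoc ww)
qed

text \<open>Here \<open>K\<close> stands for the modes of the past, \<open>M\<close> for those of
  block \<open>n\<close> and \<open>L\<close> for those of blocks \<open>n\<close> and
  \<open>n + 1\<close>. On matrices over the Klein image of \<open>alg L\<close>, \<open>Q\<close>
  applies \<open>P\<close> to each entry, and the module, star and positivity clauses are checked on
  entries.\<close>

lemma quasi_conditional_expectation_extension:
  assumes K: "finite K" and L: "L \<inter> K = {}" and M: "finite M" "j \<in> M" "M \<subseteq> L"
    and P: "completely_positive (alg L) (alg M) P" and P1: "P 1 = 1"
    and P_even: "even_on \<Theta> (alg L) P" and even_P: "\<And>x. x \<in> alg L \<Longrightarrow> \<Theta> (P x) = P x"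
    and Q: "linear_map_on (alg (K \<union> L)) S Q"
    and Q_mult: "\<And>x y. x \<in> alg K \<Longrightarrow> y \<in> alg L \<Longrightarrow> Q (x * y) = x * P y"
  shows "quasi_conditional_expectation (alg K) (alg K \<or>\<^sub>* even_part \<Theta> (alg M)) (alg (K \<union> L)) Q"
proof -
  define A where "A = alg K \<or>\<^sub>* even_part \<Theta> (alg M)"
  have A_sub: "star_subalgebra A"
    unfolding A_def star_alg_join_def by (rule star_subalgebra_generated)
  note A = star_subalgebraD[OF A_sub]
  have KA: "x \<in> A" if "x \<in> alg K" for x
    using that star_alg_generated_superset unfolding A_def star_alg_join_def by blast
  have MA: "x \<in> A" if "x \<in> even_part \<Theta> (alg M)" for x
    using that star_alg_generated_superset unfolding A_def star_alg_join_def by blast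
  have sub: "alg K \<subseteq> alg (K \<union> L)" "alg L \<subseteq> alg (K \<union> L)" "alg M \<subseteq> alg L"
    using M(3) by (auto intro!: alg_mono)
  have KMA: "x * z \<in> A" if "x \<in> alg K" "z \<in> even_part \<Theta> (alg M)" for x z
    using that by (intro A(8) KA MA)
  have AKL: "A \<subseteq> alg (K \<union> L)"
    unfolding A_def star_alg_join_def
    using sub by (intro star_alg_generated_minimal star_subalgebra_alg) (auto simp: even_part_def)
  obtain V where V: "parity_op K V"
    using parity_op_exists[OF K] by blast
  obtain e where "matrix_units (Pow K) e" "units_span (Pow K) e = alg K"
    using matrix_units_exist[OF K] by blast
  moreover define U where "U = Pow K"
  ultimately have e: "matrix_units U e" "units_span U e = alg K"
    by simp_all
  note mu = matrix_unitsD[OF e(1)]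
  have e_alg: "e p q \<in> alg K" if "p \<in> U" "q \<in> U" for p q
    using units_span_base[OF that, of e] e(2) by simp
  have P_lin: "P x \<in> alg M" "P (x + y) = P x + P y" "P (c *\<^sub>C x) = c *\<^sub>C P x"
    if "x \<in> alg L" "y \<in> alg L" for x y c
    using P that unfolding completely_positive_def linear_map_on_def by blast+
  have P_in: "P x \<in> even_part \<Theta> (alg M)" if "x \<in> alg L" for x
    using P_lin(1)[OF that that] even_P[OF that] by (simp add: even_part_def)
  \<comment> \<open>On an odd element, evenness of \<open>P\<close> makes the value equal to its own
    negative.\<close>
  have P_od: "P (od y) = 0" if "y \<in> alg L" for y
  proof -
    have "P (\<Theta> (od y)) = P (od y)"
      using P_even ev_od_in_alg(2)[OF that] unfolding even_on_def by blast
    moreover have "P (\<Theta> (od y)) = - P (od y)"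
      using P_lin(3)[of "od y" "od y" "-1"] ev_od_in_alg(2)[OF that] by (simp add: \<Theta>_od)
    ultimately have "P (od y) + P (od y) = 0"
      by (metis add.right_inverse)
    then show ?thesis
      using scaleC_add_right[of "1/2" "P (od y)" "P (od y)"] by simp
  qed
  have P_ev: "P (ev y) = P y" if "y \<in> alg L" for y
    using P_lin(2)[OF ev_od_in_alg[OF that]] P_od[OF that] by (simp add: ev_od)
  have tw_in: "twist V y \<in> alg (K \<union> L)" if "y \<in> alg L" for y
    unfolding twist_def using that sub parity_opD(1)[OF V] ev_od_in_alg[OF that]
    by (auto intro!: algI)
  have Q_lin: "Q (x + y) = Q x + Q y"
    if "x \<in> alg (K \<union> L)" "y \<in> alg (K \<union> L)" for x y
    using Q that unfolding linear_map_on_def by blast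
  have Q_scale: "Q (c *\<^sub>C x) = c *\<^sub>C Q x" if "x \<in> alg (K \<union> L)" for c x
    using Q that unfolding linear_map_on_def by blast
  note Q_sum = linear_map_on_sum[OF Q algI(1)]
  \<comment> \<open>The Klein factor is invisible to \<open>Q\<close>: it only affects the odd part,
    which \<open>P\<close> annihilates.\<close>
  have Q_tw: "Q (x * twist V y) = x * P y" if "x \<in> alg K" "y \<in> alg L" for x y
  proof -
    have xV: "x * V \<in> alg K"
      using that(1) parity_opD(1)[OF V] by (rule algI)
    have "Q (x * twist V y) = Q (x * ev y + x * V * od y)"
      by (simp add: twist_def distrib_left mult.assoc)
    also have "\<dots> = Q (x * ev y) + Q (x * V * od y)"
      using that(1) parity_opD(1)[OF V] ev_od_in_alg[OF that(2)] sub
      by (intro Q_lin algI(8)) auto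
    also have "\<dots> = x * P y"
      using that xV ev_od_in_alg[OF that(2)] by (simp add: Q_mult P_ev P_od)
    finally show ?thesis .
  qed
  \<comment> \<open>Even elements are their own Klein transforms, so they commute with
    \<open>alg K\<close>.\<close>
  have comm: "z * x = x * z" if "x \<in> alg K" "z \<in> even_part \<Theta> (alg M)" for x z
  proof -
    have "z \<in> alg L" "twist V z = z"
      using that(2) sub by (auto simp: even_part_def twist_def ev_eq od_eq)
    then show ?thesis
      using twist_commute[OF V L that(1), of z] by simp
  qed
  have decomp: "\<exists>y. (\<forall>p q. y p q \<in> alg L) \<and> z = (\<Sum>p\<in>U. \<Sum>q\<in>U. e p q * twist V (y p q))"
    if "z \<in> alg (K \<union> L)" for z
    by (rule twist_decomposition[OF V K L e that])
  have prod_in: "x * twist V y \<in> alg (K \<union> L)" if "x \<in> alg K" "y \<in> alg L" for x y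
    using that tw_in sub by (intro algI(8)) auto
  \<comment> \<open>This is the entrywise action; the left factors are kept general so that it also
    serves the adjoint and module computations.\<close>
  have Q_double: "Q (\<Sum>p\<in>U. \<Sum>q\<in>U. x p q * twist V (y p q)) = (\<Sum>p\<in>U. \<Sum>q\<in>U. x p q * P (y p q))"
    if "\<And>p q. p \<in> U \<Longrightarrow> q \<in> U \<Longrightarrow> x p q \<in> alg K" "\<And>p q. y p q \<in> alg L" for x y :: "nat set \<Rightarrow> nat set \<Rightarrow> 'a"
  proof -
    have "Q (\<Sum>p\<in>U. \<Sum>q\<in>U. x p q * twist V (y p q)) = (\<Sum>p\<in>U. Q (\<Sum>q\<in>U. x p q * twist V (y p q)))"
      using that prod_in by (intro Q_sum algI(10)) auto
    also have "\<dots> = (\<Sum>p\<in>U. \<Sum>q\<in>U. Q (x p q * twist V (y p q)))"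
      using that prod_in by (intro sum.cong refl Q_sum) auto
    also have "\<dots> = (\<Sum>p\<in>U. \<Sum>q\<in>U. x p q * P (y p q))"
      using that by (intro sum.cong refl Q_tw) auto
    finally show ?thesis .
  qed
  have Q_in: "Q z \<in> A" if "z \<in> alg (K \<union> L)" for z
  proof -
    obtain y where y: "\<And>p q. y p q \<in> alg L" "z = (\<Sum>p\<in>U. \<Sum>q\<in>U. e p q * twist V (y p q))"
      using decomp[OF \<open>z \<in> _\<close>] by blast
    have "Q z = (\<Sum>p\<in>U. \<Sum>q\<in>U. e p q * P (y p q))"
      unfolding y(2) by (rule Q_double[OF e_alg y(1)])
    then show ?thesis
      using y(1) by (simp add: A(10) KMA e_alg P_in)
  qed
  have Q_star: "Q (star z) = star (Q z)" if "z \<in> alg (K \<union> L)" for z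
  proof -
    obtain f where f: "matrix_units (Pow M) f" "units_span (Pow M) f = alg M"
      using matrix_units_exist[OF M(1)] by blast
    have P_star: "P (star y) = star (P y)" if "y \<in> alg L" for y
      by (rule completely_positive_star[OF f P star_subalgebra_alg that])
    obtain y where y: "\<And>p q. y p q \<in> alg L" "z = (\<Sum>p\<in>U. \<Sum>q\<in>U. e p q * twist V (y p q))"
      using decomp[OF \<open>z \<in> _\<close>] by blast
    have "star z = (\<Sum>p\<in>U. \<Sum>q\<in>U. e q p * twist V (star (y p q)))"
      unfolding y(2) star_sum
    proof (intro sum.cong refl)
      fix p q assume "p \<in> U" "q \<in> U"
      then show "star (e p q * twist V (y p q)) = e q p * twist V (star (y p q))"
        using twist_commute[OF V L e_alg algI(9)[OF y(1)]]
        by (simp add: star_mult mu twist_star[OF V L y(1)])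
    qed
    then have "Q (star z) = (\<Sum>p\<in>U. \<Sum>q\<in>U. e q p * P (star (y p q)))"
      using Q_double[of "\<lambda>p q. e q p" "\<lambda>p q. star (y p q)"] e_alg y(1) by (simp add: algI)
    also have "\<dots> = star (\<Sum>p\<in>U. \<Sum>q\<in>U. e p q * P (y p q))"
      unfolding star_sum
    proof (intro sum.cong refl)
      fix p q assume "p \<in> U" "q \<in> U"
      then show "e q p * P (star (y p q)) = star (e p q * P (y p q))"
        using comm[OF e_alg P_in[OF algI(9)[OF y(1)]]] by (simp add: star_mult mu flip: P_star[OF y(1)])
    qed
    also have "(\<Sum>p\<in>U. \<Sum>q\<in>U. e p q * P (y p q)) = Q z"
      unfolding y(2) by (rule Q_double[OF e_alg y(1), symmetric])
    finally show ?thesis .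
  qed
  have Q_module: "Q (c * z) = c * Q z" if z: "z \<in> alg (K \<union> L)" and c: "c \<in> alg K" for c z
  proof -
    obtain y where y: "\<And>p q. y p q \<in> alg L" "z = (\<Sum>p\<in>U. \<Sum>q\<in>U. e p q * twist V (y p q))"
      using decomp[OF z] by blast
    have "Q (c * z) = Q (\<Sum>p\<in>U. \<Sum>q\<in>U. c * e p q * twist V (y p q))"
      by (simp add: y(2) sum_distrib_left mult.assoc)
    also have "\<dots> = (\<Sum>p\<in>U. \<Sum>q\<in>U. c * e p q * P (y p q))"
      by (rule Q_double[OF algI(8)[OF c e_alg] y(1)])
    also have "\<dots> = c * Q z"
      using Q_double[of e y, OF e_alg y(1)] unfolding y(2) by (simp add: sum_distrib_left mult.assoc)
    finally show ?thesis .
  qed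
  have Q1: "Q 1 = 1"
    using Q_mult[of 1 1] by (simp add: algI P1)
  have cp: "positive_in A (\<Sum>j<m. \<Sum>k<m. star (b j) * Q (star (d j) * d k) * b k)"
    if b: "\<And>j. j < m \<Longrightarrow> b j \<in> A" and d: "\<And>j. j < m \<Longrightarrow> d j \<in> alg (K \<union> L)" for m :: nat and b d
  proof -
    define rep where "rep z y \<longleftrightarrow> (\<forall>p q. y p q \<in> alg L) \<and> z = (\<Sum>p\<in>U. \<Sum>q\<in>U. e p q * twist V (y p q))"
      for z y
    have "\<exists>y. rep (d i) y" if "i < m" for i
      unfolding rep_def by (rule decomp[OF d[OF that]])
    then obtain y where rep: "\<And>i. i < m \<Longrightarrow> rep (d i) (y i)"
      by metis
    then have y: "y i p q \<in> alg L" "d i = (\<Sum>p\<in>U. \<Sum>q\<in>U. e p q * twist V (y i p q))"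
      if "i < m" for i p q
      using that unfolding rep_def by blast+
    \<comment> \<open>One common Gram decomposition is taken for all matrix entries of all
      \<open>d i\<close>, so that the same index set works for every pair.\<close>
    define I where "I = {..<m} \<times> U \<times> U"
    define Y where "Y = (\<lambda>(i, p, q). y i p q)"
    have finI: "finite I"
      using mu(1) by (simp add: I_def)
    have YI: "Y x \<in> alg L" if "x \<in> I" for x
      using that y(1) by (auto simp: I_def Y_def)
    have "\<exists>(A :: (nat \<times> bool) set) F. finite A \<and> (\<forall>k\<in>A. \<forall>x\<in>I. F k x \<in> even_part \<Theta> (alg M))
        \<and> (\<forall>x\<in>I. \<forall>x'\<in>I. P (star (Y x) * Y x') = (\<Sum>k\<in>A. star (F k x) * F k x'))"
      by (rule even_gram[OF M(1,2) P star_subalgebra_alg even_P finI YI])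
    then obtain F and X :: "(nat \<times> bool) set" where X: "finite X"
      "\<forall>\<alpha>\<in>X. \<forall>x\<in>I. F \<alpha> x \<in> even_part \<Theta> (alg M)"
      "\<forall>x\<in>I. \<forall>x'\<in>I. P (star (Y x) * Y x') = (\<Sum>\<alpha>\<in>X. star (F \<alpha> x) * F \<alpha> x')"
      by (elim exE conjE)
    have "U \<noteq> {}"
      using mu(4) by auto
    then obtain u where u: "u \<in> U"
      by blast
    \<comment> \<open>The row \<open>u\<close> is fixed, so
      \<open>star (e u q) * e u q' = e q q'\<close>; the even vectors commute with the units and do
      not disturb this. The index \<open>p\<close> records the row of the entry of
      \<open>d i\<close>.\<close>
    define G where "G = (\<lambda>(p, \<alpha>) i. \<Sum>q\<in>U. e u q * F \<alpha> (i, p, q))"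
    have G_in: "G x i \<in> A" if "x \<in> U \<times> X" "i < m" for x i
      using that u X(2) by (auto simp: G_def I_def intro!: A(10) KMA e_alg)
    have Q_gram: "Q (star (d i) * d k) = (\<Sum>x\<in>U \<times> X. star (G x i) * G x k)"
      if i: "i < m" and k: "k < m" for i k
    proof -
      \<comment> \<open>Only equal row indices survive, which leaves a single sum over
        \<open>p\<close> in the product.\<close>
      have prod: "star (e p q * twist V (y i p q)) * (e p' q' * twist V (y k p' q'))
          = (if p = p' then e q q' * twist V (star (y i p q) * y k p q') else 0)"
        if "p \<in> U" "q \<in> U" "p' \<in> U" "q' \<in> U" for p q p' q'
      proof -
        have c: "twist V (star (y i p q)) * (e q p * z) = e q p * (twist V (star (y i p q)) * z)"
          for z
          using twist_commute[OF V L e_alg[OF that(2,1)] algI(9)[OF y(1)[OF i, of p q]]]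
          by (metis mult.assoc)
        have c': "twist V (star (y i p q)) * (e p' q' * z) = e p' q' * (twist V (star (y i p q)) * z)"
          for z
          using twist_commute[OF V L e_alg[OF that(3,4)] algI(9)[OF y(1)[OF i, of p q]]]
          by (metis mult.assoc)
        have "star (e p q * twist V (y i p q)) * (e p' q' * twist V (y k p' q'))
            = (e q p * e p' q') * (twist V (star (y i p q)) * twist V (y k p' q'))"
          using that by (simp add: star_mult mu(3) twist_star[OF V L y(1)[OF i], symmetric] mult.assoc c c')
        also have "\<dots> = (if p = p' then e q q' * twist V (star (y i p q) * y k p q') else 0)"
          unfolding twist_mult[OF V L algI(9)[OF y(1)[OF i, of p q]] y(1)[OF k, of p' q'], symmetric]
          using that by (simp add: mu(2))
        finally show ?thesis .
      qed
      have "star (d i) * d k = (\<Sum>p\<in>U. \<Sum>q\<in>U. \<Sum>p'\<in>U. \<Sum>q'\<in>U.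
          star (e p q * twist V (y i p q)) * (e p' q' * twist V (y k p' q')))"
        unfolding y(2)[OF i] y(2)[OF k] star_sum sum_distrib_right
        by (simp only: sum_distrib_left)
      also have "\<dots> = (\<Sum>p\<in>U. \<Sum>q\<in>U. \<Sum>p'\<in>U. if p = p'
          then \<Sum>q'\<in>U. e q q' * twist V (star (y i p q) * y k p q') else 0)"
        by (intro sum.cong refl) (simp add: prod cong: sum.cong)
      also have "\<dots> = (\<Sum>p\<in>U. \<Sum>q\<in>U. \<Sum>q'\<in>U. e q q' * twist V (star (y i p q) * y k p q'))"
        using mu(1) by (simp cong: sum.cong)
      finally have "Q (star (d i) * d k)
          = Q (\<Sum>p\<in>U. \<Sum>q\<in>U. \<Sum>q'\<in>U. e q q' * twist V (star (y i p q) * y k p q'))"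
        by simp
      also have "\<dots> = (\<Sum>p\<in>U. Q (\<Sum>q\<in>U. \<Sum>q'\<in>U. e q q' * twist V (star (y i p q) * y k p q')))"
        using y(1)[OF i] y(1)[OF k] by (intro Q_sum algI(10) prod_in e_alg algI(8,9)) auto
      also have "\<dots> = (\<Sum>p\<in>U. \<Sum>q\<in>U. \<Sum>q'\<in>U. e q q' * P (star (y i p q) * y k p q'))"
        using y(1)[OF i] y(1)[OF k] by (intro sum.cong refl Q_double e_alg algI(8,9)) auto
      also have "\<dots> = (\<Sum>p\<in>U. \<Sum>q\<in>U. \<Sum>q'\<in>U. \<Sum>\<alpha>\<in>X.
          star (e u q * F \<alpha> (i, p, q)) * (e u q' * F \<alpha> (k, p, q')))"
      proof (intro sum.cong refl)
        fix p q q' assume p: "p \<in> U" and q: "q \<in> U" and q': "q' \<in> U"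
        have I: "(i, p, q) \<in> I" "(k, p, q') \<in> I"
          using i k p q q' by (auto simp: I_def)
        have "e q q' * P (star (y i p q) * y k p q')
            = (\<Sum>\<alpha>\<in>X. e q q' * (star (F \<alpha> (i, p, q)) * F \<alpha> (k, p, q')))"
          using bspec[OF bspec[OF X(3) I(1)] I(2)] by (simp add: Y_def sum_distrib_left)
        also have "\<dots> = (\<Sum>\<alpha>\<in>X. star (e u q * F \<alpha> (i, p, q)) * (e u q' * F \<alpha> (k, p, q')))"
        proof (intro sum.cong refl)
          fix \<alpha> assume "\<alpha> \<in> X"
          then have F: "F \<alpha> (i, p, q) \<in> even_part \<Theta> (alg M)"
            using X(2) I by blast
          have c: "star (F \<alpha> (i, p, q)) * e q q' = e q q' * star (F \<alpha> (i, p, q))"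
            using F by (intro comm e_alg q q') (auto simp: even_part_def \<Theta>_star algI)
          have "star (e u q * F \<alpha> (i, p, q)) * (e u q' * F \<alpha> (k, p, q'))
              = star (F \<alpha> (i, p, q)) * (star (e u q) * e u q') * F \<alpha> (k, p, q')"
            by (simp add: star_mult mult.assoc)
          also have "star (e u q) * e u q' = e q q'"
            using u q q' by (simp add: mu)
          finally show "e q q' * (star (F \<alpha> (i, p, q)) * F \<alpha> (k, p, q'))
              = star (e u q * F \<alpha> (i, p, q)) * (e u q' * F \<alpha> (k, p, q'))"
            by (simp add: c mult.assoc)
        qed
        finally show "e q q' * P (star (y i p q) * y k p q')
            = (\<Sum>\<alpha>\<in>X. star (e u q * F \<alpha> (i, p, q)) * (e u q' * F \<alpha> (k, p, q')))" .
      qed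
      also have "\<dots> = (\<Sum>p\<in>U. \<Sum>q\<in>U. \<Sum>\<alpha>\<in>X. \<Sum>q'\<in>U.
          star (e u q * F \<alpha> (i, p, q)) * (e u q' * F \<alpha> (k, p, q')))"
        by (intro sum.cong refl sum.swap)
      also have "\<dots> = (\<Sum>p\<in>U. \<Sum>\<alpha>\<in>X. \<Sum>q\<in>U. \<Sum>q'\<in>U.
          star (e u q * F \<alpha> (i, p, q)) * (e u q' * F \<alpha> (k, p, q')))"
        by (intro sum.cong refl sum.swap)
      also have "\<dots> = (\<Sum>p\<in>U. \<Sum>\<alpha>\<in>X. star (G (p, \<alpha>) i) * G (p, \<alpha>) k)"
        by (simp only: G_def prod.case star_sum sum_product)
      finally show ?thesis
        by (simp add: sum.cartesian_product')
    qed
    \<comment> \<open>The elements \<open>b j\<close> are absorbed into the Gram vectors, leaving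
      one square for each pair in \<open>U\<close> times \<open>X\<close>.\<close>
    have "(\<Sum>j<m. \<Sum>k<m. star (b j) * Q (star (d j) * d k) * b k)
        = (\<Sum>j<m. \<Sum>k<m. \<Sum>x\<in>U \<times> X. star (G x j * b j) * (G x k * b k))"
      by (intro sum.cong refl) (simp add: Q_gram sum_distrib_left sum_distrib_right star_mult mult.assoc)
    also have "\<dots> = (\<Sum>j<m. \<Sum>x\<in>U \<times> X. \<Sum>k<m. star (G x j * b j) * (G x k * b k))"
      by (intro sum.cong refl sum.swap)
    also have "\<dots> = (\<Sum>x\<in>U \<times> X. \<Sum>j<m. \<Sum>k<m. star (G x j * b j) * (G x k * b k))"
      by (rule sum.swap)
    also have "\<dots> = (\<Sum>x\<in>U \<times> X. star (\<Sum>j<m. G x j * b j) * (\<Sum>k<m. G x k * b k))"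
      by (simp only: star_sum sum_product)
    finally show ?thesis
      using mu(1) X(1) G_in b by (auto intro!: positive_in_sum A(8,10))
  qed
  have Q_map: "linear_map_on (alg (K \<union> L)) A Q"
    using Q_in Q_lin Q_scale unfolding linear_map_on_def by blast
  have "completely_positive (alg (K \<union> L)) A Q"
    unfolding completely_positive_def using Q_map cp by simp
  then show ?thesis
    unfolding quasi_conditional_expectation_def A_def[symmetric]
    using A_sub star_subalgebra_alg KA AKL Q_star Q1 Q_module by blast
qed

end

text \<open>Evenness of the values of \<open>E\<close> places them in the middle algebra of the
  triplet. For \<open>n > 0\<close> it is derived from the commutant condition; for
  \<open>n = 0\<close> the past consists of scalars, that condition says nothing, and the last
  hypothesis supplies the evenness. Uniqueness is asserted on the domain, as values elsewhere carry
  no meaning.\<close>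

theorem theorem6:
  fixes a :: "nat \<Rightarrow> 'a::complex_star_algebra"
    and J :: "nat \<Rightarrow> nat set"
    and \<Theta> E :: "'a \<Rightarrow> 'a"
    and B :: "nat \<Rightarrow> 'a set"
    and n :: nat
  assumes "fermi_generators a"
    and "parity_automorphism a \<Theta>"
    and "finite_partition J"
    and "\<And>m. linear_basis (B m) (block_alg a J {m})"
    and "backward_markov_transition_expectation a J n E"
    and "even_on \<Theta> (block_alg a J {n..n+1}) E"
    and "n = 0 \<Longrightarrow> E ` block_alg a J {n..n+1} \<subseteq> even_part \<Theta> (block_alg a J {n})"
  defines "Et \<equiv> extended_expectation B n E"
  shows "linear_map_on (block_alg a J {..n+1}) (block_alg a J {..n}) Et
    \<and> (\<forall>x\<in>block_alg a J {..<n}. \<forall>y\<in>block_alg a J {n..n+1}. Et (x * y) = x * E y)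
    \<and> (\<forall>G. linear_map_on (block_alg a J {..n+1}) (block_alg a J {..n}) G
          \<and> (\<forall>x\<in>block_alg a J {..<n}. \<forall>y\<in>block_alg a J {n..n+1}. G (x * y) = x * E y)
          \<longrightarrow> (\<forall>z\<in>block_alg a J {..n+1}. G z = Et z))
    \<and> quasi_conditional_expectation
        (block_alg a J {..<n})
        (block_alg a J {..<n} \<or>\<^sub>* even_part \<Theta> (block_alg a J {n}))
        (block_alg a J {..n+1})
        Et"
proof -
  interpret fermi a \<Theta>
    by standard (use assms in auto)
  define K where "K = (\<Union>m<n. J m)"
  define L where "L = J n \<union> J (n + 1)"
  have J: "finite (J m)" "J m \<noteq> {}" "disjoint_family J" for m
    using assms(3) by (simp_all add: finite_partition_def)
  have disj: "J i \<inter> J k = {}" if "i \<noteq> k" for i k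
    using disjoint_family_onD[OF J(3) _ _ that] by simp
  have K: "finite K"
    using J(1) by (simp add: K_def)
  have "J n \<inter> J m = {}" "J (n + 1) \<inter> J m = {}" if "m < n" for m
    using disj[of n m] disj[of "n + 1" m] that by simp_all
  then have LK: "L \<inter> K = {}" and MK: "J n \<inter> K = {}"
    unfolding L_def K_def by blast+
  \<comment> \<open>The blocks \<open>0\<close> to \<open>n + 1\<close> are \<open>n + 2\<close> in
    number, hence the length of the ordered products.\<close>
  have union: "(\<Union>m<n + 2. J m) = K \<union> L"
    by (auto simp: K_def L_def lessThan_Suc numeral_2_eq_2)
  have sets: "{n..n + 1} = {n, n + 1}" "{..n + 1} = {..<n + 2}"
    by auto
  have blocks: "block_alg a J {m} = alg (J m)" "block_alg a J {..<n} = alg K"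
    "block_alg a J {n..n + 1} = alg L" "block_alg a J {..n + 1} = alg (K \<union> L)" for m
    unfolding block_alg_def alg_def union[symmetric] sets by (simp_all add: K_def L_def)
  have block_n: "block_alg a J {..n} = alg (K \<union> J n)"
  proof -
    have "{..n} = insert n {..<n}"
      by auto
    then show ?thesis
      by (simp add: block_alg_def alg_def K_def Un_commute)
  qed
  have B: "linear_basis (B m) (alg (J m))" for m
    using assms(4)[of m] by (simp add: blocks)
  have E: "completely_positive (alg L) (alg (J n)) E" "E 1 = 1"
    and E_in: "\<And>y. y \<in> alg L \<Longrightarrow> E y \<in> commutant (alg K)" "\<And>y. y \<in> alg L \<Longrightarrow> E y \<in> alg (J n)"
    using assms(5) unfolding backward_markov_transition_expectation_def blocks by auto
  have E_even: "\<Theta> (E y) = E y" if y: "y \<in> alg L" for y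
  proof (cases "n = 0")
    case True
    then show ?thesis
      using assms(7)[unfolded blocks, OF True] y by (auto simp: even_part_def)
  next
    case False
    \<comment> \<open>Block \<open>0\<close> lies in the past and is nonempty, so the past contains
      a mode and \<open>commutant_even\<close> applies.\<close>
    obtain k where "k \<in> J 0"
      using J(2) by blast
    then have "k \<in> K"
      using False by (auto simp: K_def)
    then show ?thesis
      using commutant_even MK E_in[OF y] by blast
  qed
  note ob = ordered_product_basis[of J B, OF J(1,3) B]
  have ob_n: "cvec.span (ordered_basis B n) = alg K"
    using ob[of n] by (simp add: linear_basis_def K_def)
  have inj: "inj_on (\<lambda>e. ordered_product e (n + 2)) (\<Pi>\<^sub>E k\<in>{..<n+2}. B k)"
    and ind: "cvec.independent (ordered_basis B (n + 2))"
    and span: "cvec.span (ordered_basis B (n + 2)) = alg (K \<union> L)"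
    using ob[of "n + 2"] unfolding union by (simp_all add: linear_basis_def)
  have span_L: "cvec.span ((\<lambda>(x, y). x * y) ` (B n \<times> B (n + 1))) = alg L"
    using product_basis(2)[OF J(1) _ B B, of "n + 1" n] disj[of "n + 1" n]
    by (simp add: linear_basis_def L_def)
  have fin: "finite (\<Pi>\<^sub>E k\<in>{..<n+2}. B k)"
    using finite_linear_basis[OF J(1) B] by (intro finite_PiE) auto
  have sub: "alg K \<subseteq> alg (K \<union> L)" "alg L \<subseteq> alg (K \<union> L)" "alg K \<subseteq> alg (K \<union> J n)" "alg (J n) \<subseteq> alg (K \<union> J n)"
    by (auto intro!: alg_mono)
  have prod_mem: "ordered_product e N \<in> cvec.span (ordered_basis B N)" if "e \<in> (\<Pi> k\<in>{..<N}. B k)" for e N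
  proof -
    have "ordered_product (restrict e {..<N}) N = ordered_product e N"
      by (rule ordered_product_cong) simp
    moreover have "restrict e {..<N} \<in> (\<Pi>\<^sub>E k\<in>{..<N}. B k)"
      using that by simp
    ultimately show ?thesis
      unfolding ordered_basis_def by (metis cvec.span_base image_eqI)
  qed
  have BL: "b \<in> alg L" if "b \<in> B n \<or> b \<in> B (n + 1)" for b
  proof -
    have "b \<in> alg (J n) \<union> alg (J (n + 1))"
      using that B[of n] B[of "n + 1"] cvec.span_base unfolding linear_basis_def by blast
    then show ?thesis
      using alg_mono[of "J n" L] alg_mono[of "J (n + 1)" L] by (auto simp: L_def)
  qed
  have Et_in: "Et z \<in> alg (K \<union> J n)" for z
    unfolding Et_def extended_expectation_def
  proof (intro algI(7,8,10))
    fix e assume e: "e \<in> (\<Pi>\<^sub>E k\<in>{..<n+2}. B k)"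
    have "e \<in> (\<Pi> k\<in>{..<n}. B k)" and en: "e n \<in> B n" "e (n + 1) \<in> B (n + 1)"
      by (use e in \<open>auto simp: PiE_iff\<close>)
    then show "ordered_product e n \<in> alg (K \<union> J n)"
      using prod_mem[of e n] sub(3) unfolding ob_n by blast
    have "e n * e (n + 1) \<in> alg L"
      using en BL by (intro algI(8)) blast+
    then show "E (e n * e (n + 1)) \<in> alg (K \<union> J n)"
      using E_in(2) sub(4) by blast
  qed
  have Et_add: "Et (x + y) = Et x + Et y" if "x \<in> alg (K \<union> L)" "y \<in> alg (K \<union> L)" for x y
    unfolding Et_def extended_expectation_def
      cvec.representation_add[OF ind that(2,1)[folded span]]
    by (simp add: scaleC_add_left sum.distrib)
  have Et_scale: "Et (c *\<^sub>C x) = c *\<^sub>C Et x" if "x \<in> alg (K \<union> L)" for c x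
    unfolding Et_def extended_expectation_def cvec.representation_scale[OF ind that[folded span]]
    by (simp add: cvec.scale_sum_right scaleC_scaleC)
  have Et_basis: "Et (ordered_product e (n + 2)) = ordered_product e n * E (e n * e (n + 1))"
    if e: "e \<in> (\<Pi>\<^sub>E k\<in>{..<n+2}. B k)" for e
  proof -
    have "ordered_product e (n + 2) \<in> ordered_basis B (n + 2)"
      using e unfolding ordered_basis_def by blast
    then have rep: "cvec.representation (ordered_basis B (n + 2)) (ordered_product e (n + 2))
        = (\<lambda>v. if v = ordered_product e (n + 2) then 1 else 0)"
      by (rule cvec.representation_basis[OF ind])
    \<comment> \<open>By injectivity the delta at the product is a delta at the tuple, and the
      finite sum collapses.\<close>
    have "Et (ordered_product e (n + 2)) = (\<Sum>e'\<in>(\<Pi>\<^sub>E k\<in>{..<n+2}. B k).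
        if e' = e then ordered_product e' n * E (e' n * e' (n + 1)) else 0)"
      unfolding Et_def extended_expectation_def rep
      using inj_on_eq_iff[OF inj _ e] by (intro sum.cong refl) auto
    then show ?thesis
      using fin e by simp
  qed
  have prod_in: "x * y \<in> alg (K \<union> L)" if "x \<in> alg K" "y \<in> alg L" for x y
    using that sub by (intro algI(8)) auto
  have Et_basis': "Et (x * (b * c)) = x * E (b * c)"
    if x: "x \<in> ordered_basis B n" and b: "b \<in> B n" and c: "c \<in> B (n + 1)" for x b c
  proof -
    obtain e where e: "x = ordered_product e n" "e \<in> (\<Pi>\<^sub>E k\<in>{..<n}. B k)"
      using x by (auto simp: ordered_basis_def)
    define e' where "e' = e(n := b, n + 1 := c)"
    have "e' \<in> (\<Pi>\<^sub>E k\<in>{..<n+2}. B k)"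
      using e(2) b c by (auto simp: e'_def PiE_iff extensional_def less_Suc_eq)
    moreover have "ordered_product e' n = x"
      unfolding e(1) by (rule ordered_product_cong) (simp add: e'_def)
    moreover have "e' n = b" "e' (n + 1) = c"
      by (simp_all add: e'_def)
    ultimately show ?thesis
      using Et_basis[of e'] by (simp add: ordered_product_Suc mult.assoc)
  qed
  have E_lin: "E (x + y) = E x + E y" "E (c *\<^sub>C x) = c *\<^sub>C E x" if "x \<in> alg L" "y \<in> alg L" for x y c
    using E(1) that unfolding completely_positive_def linear_map_on_def by blast+
  have Et_map: "linear_map_on (alg (K \<union> L)) (alg (K \<union> J n)) Et"
    using Et_in Et_add Et_scale by (simp add: linear_map_on_def)
  \<comment> \<open>The product formula is extended one factor at a time: first to all left factors
    in \<open>alg K\<close>, then in \<open>Et_mult\<close> to all right factors in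
    \<open>alg L\<close>.\<close>
  have Et_left: "Et (x * (b * c)) = x * E (b * c)"
    if "b \<in> B n" "c \<in> B (n + 1)" "x \<in> alg K" for x b c
  proof (rule linear_maps_agree_on_span[where D = "alg K" and S = UNIV and T = UNIV
        and F = "\<lambda>x. Et (x * (b * c))" and G = "\<lambda>x. x * E (b * c)"])
    have bc: "b * c \<in> alg L"
      using that BL by (intro algI(8)) auto
    show "linear_map_on (alg K) UNIV (\<lambda>x. Et (x * (b * c)))"
      using bc by (simp add: linear_map_on_def distrib_right mult_scaleC_left Et_add Et_scale prod_in)
    show "linear_map_on (alg K) UNIV (\<lambda>x. x * E (b * c))"
      by (simp add: linear_map_on_def distrib_right mult_scaleC_left)
    show "cvec.subspace (alg K)"
      by (rule algI)
    show "ordered_basis B n \<subseteq> alg K" "x \<in> cvec.span (ordered_basis B n)"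
      using cvec.span_superset[of "ordered_basis B n"] that(3) by (simp_all add: ob_n)
  qed (rule Et_basis'[OF _ that(1,2)])
  have Et_mult: "Et (x * y) = x * E y" if x: "x \<in> alg K" and y: "y \<in> alg L" for x y
  proof (rule linear_maps_agree_on_span[where D = "alg L" and S = UNIV and T = UNIV
        and F = "\<lambda>y. Et (x * y)" and G = "\<lambda>y. x * E y"])
    show "linear_map_on (alg L) UNIV (\<lambda>y. Et (x * y))"
      using x by (simp add: linear_map_on_def distrib_left mult_scaleC_right Et_add Et_scale prod_in)
    show "linear_map_on (alg L) UNIV (\<lambda>y. x * E y)"
      by (simp add: linear_map_on_def distrib_left mult_scaleC_right E_lin)
    show "cvec.subspace (alg L)"
      by (rule algI)
    show "(\<lambda>(x, y). x * y) ` (B n \<times> B (n + 1)) \<subseteq> alg L"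
      "y \<in> cvec.span ((\<lambda>(x, y). x * y) ` (B n \<times> B (n + 1)))"
      using cvec.span_superset[of "(\<lambda>(x, y). x * y) ` (B n \<times> B (n + 1))"] y
      unfolding span_L by blast+
  qed (use Et_left x in auto)
  \<comment> \<open>The products on which both maps are prescribed span the whole domain.\<close>
  have unique: "G z = Et z"
    if G: "linear_map_on (alg (K \<union> L)) (alg (K \<union> J n)) G"
      and G_mult: "\<forall>x\<in>alg K. \<forall>y\<in>alg L. G (x * y) = x * E y" and z: "z \<in> alg (K \<union> L)" for G z
  proof (rule linear_maps_agree_on_span[OF G Et_map])
    show "cvec.subspace (alg (K \<union> L))"
      by (rule algI)
    show "{x * y |x y. x \<in> alg K \<and> y \<in> alg L} \<subseteq> alg (K \<union> L)"
      using prod_in by blast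
    show "z \<in> cvec.span {x * y |x y. x \<in> alg K \<and> y \<in> alg L}"
      using z by (simp add: span_products_alg[OF K LK])
  qed (use G_mult Et_mult in auto)
  obtain j where j: "j \<in> J n"
    using J(2) by blast
  have "quasi_conditional_expectation (alg K) (alg K \<or>\<^sub>* even_part \<Theta> (alg (J n))) (alg (K \<union> L)) Et"
    using assms(6) unfolding blocks
    by (intro quasi_conditional_expectation_extension[OF K LK J(1) j _ E _ E_even Et_map Et_mult])
      (auto simp: L_def)
  then show ?thesis
    unfolding blocks block_n using Et_map Et_mult unique by blast
qed

end
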